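(* Let $1\le k\le n-1$, let $f(x)=g(|x|)$ on $\mathbb{R}^n$ be a radial density function with $g(t)\ge 0$ and $g'(t)\ge 0$ for $t>0$. Then every $k$-dimensional plane $\mathbb{R}^k\subset\mathbb{R}^n$ through the origin is $f$-stable for the functional $\mathcal{E}_f(M)=\int_M f(x)\,d\mathcal{H}_k$.
   Context: $\mathcal{H}_k$ is $k$-dimensional Hausdorff measure. Let $U$ be $\mathbb{R}^n$ or $\mathbb{R}^n\setminus\{0\}$, chosen so that $f$ is of class $C^2$ on $U$. Let $M\subset\mathbb{R}^n$ be a $k$-dimensional embedded $C^2$ submanifold with $U\cap M\neq\varnothing$ and $U\cap(\overline{M}\setminus M)=\varnothing$. Let $D$ be the flat connection of $\mathbb{R}^n$, let $(\cdot)^\perp$ be the projection to the normal space of $M$, let $\mathbf{B}(X,Y)=(D_XY)^\perp$ be the second fundamental form, let $e_1,\dots,e_k$ be a local orthonormal tangent frame, and let $\mathbf{H}=\sum_{i=1}^k\mathbf{B}(e_i,e_i)$ be the mean curvature vector. $M$ is $f$-stationary in $U$ if the first variation of $\mathcal{E}_f$ at $M$ vanishes for all deformations compactly supported in $U$; for $C^2$ submanifolds this is equivalent to $f\mathbf{H}=(Df)^\perp$ on $M\cap U$. An $f$-stationary $M$ is $f$-stable in $U$ if for every $C^1$ normal vector field $X$ along $M$ with compact support in $M\cap U$, $$\int_M f\Big[\sum_{i,j=1}^k\langle\mathbf{B}(e_i,e_j),X\rangle^2+\langle\mathbf{H},X\rangle^2\Big]d\mathcal{H}_k\le\int_M \Big(f\sum_{i=1}^k|(D_{e_i}X)^\perp|^2+\mathrm{Hess}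 f(X,X)\Big)d\mathcal{H}_k .$$ "$f$-stable" in the claim means $f$-stable in $U$. *)

theory Defs
  imports "HOL-Analysis.Analysis"
begin

section \<open>Classes \<open>C\<^sup>1\<close> and \<open>C\<^sup>2\<close>\<close>

text \<open>These are meant for open sets \<open>S\<close>.\<close>

definition C1_on :: "('a::real_normed_vector \<Rightarrow> 'b::real_normed_vector) \<Rightarrow> 'a set \<Rightarrow> bool" where
  "C1_on f S \<longleftrightarrow> (\<exists>f' :: 'a \<Rightarrow> ('a \<Rightarrow>\<^sub>L 'b).
     (\<forall>x\<in>S. (f has_derivative blinfun_apply (f' x)) (at x)) \<and> continuous_on S f')"

definition C2_on :: "('a::real_normed_vector \<Rightarrow> 'b::real_normed_vector) \<Rightarrow> 'a set \<Rightarrow> bool" where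
  "C2_on f S \<longleftrightarrow> (\<exists>f' :: 'a \<Rightarrow> ('a \<Rightarrow>\<^sub>L 'b).
     (\<forall>x\<in>S. (f has_derivative blinfun_apply (f' x)) (at x)) \<and> C1_on f' S)"

definition Hess :: "('a::real_normed_vector \<Rightarrow> real) \<Rightarrow> 'a \<Rightarrow> 'a \<Rightarrow> 'a \<Rightarrow> real" where
  "Hess f x u v = frechet_derivative (\<lambda>y. frechet_derivative f (at y) u) (at x) v"


section \<open>Hausdorff measure\<close>

text \<open>The case distinction only matters for \<open>k = 0\<close>, where \<open>0 ^ 0 = 1\<close>.
  Boundedness is required since \<^const>\<open>diameter\<close> is real-valued and meaningless on unbounded sets.\<close>

definition hausdorff_gauge :: "nat \<Rightarrow> 'a::euclidean_space set \<Rightarrow> ennreal" where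
  "hausdorff_gauge k C =
     (if C = {} then 0 else ennreal (unit_ball_vol (real k) * (diameter C / 2) ^ k))"

definition hausdorff_pre :: "nat \<Rightarrow> real \<Rightarrow> 'a::euclidean_space set \<Rightarrow> ennreal" where
  "hausdorff_pre k \<delta> A =
     (INF C \<in> {C :: nat \<Rightarrow> 'a set. A \<subseteq> (\<Union>i. C i) \<and> (\<forall>i. bounded (C i) \<and> diameter (C i) \<le> \<delta>)}.
        \<Sum>i. hausdorff_gauge k (C i))"

definition hausdorff_outer :: "nat \<Rightarrow> 'a::euclidean_space set \<Rightarrow> ennreal" where
  "hausdorff_outer k A = (SUP \<delta> \<in> {0<..}. hausdorff_pre k \<delta> A)"

text \<open>The outer measure is a metric outer measure, hence countably additive on Borel sets, so that
  \<^const>\<open>measure_of\<close> takes its intended (non-degenerate) value here.\<close>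

definition hausdorff_measure :: "nat \<Rightarrow> 'a::euclidean_space measure" where
  "hausdorff_measure k = measure_of UNIV (sets borel) (hausdorff_outer k)"

definition weighted_volume :: "nat \<Rightarrow> ('a::euclidean_space \<Rightarrow> real) \<Rightarrow> 'a set \<Rightarrow> real" where
  "weighted_volume k f M = (LINT x:M|hausdorff_measure k. f x)"


section \<open>Embedded submanifolds of Euclidean space\<close>

definition embedded_C2_submanifold :: "nat \<Rightarrow> 'a::euclidean_space set \<Rightarrow> bool" where
  "embedded_C2_submanifold k M \<longleftrightarrow>
     (\<forall>p\<in>M. \<exists>W V \<psi> \<psi>' L. open W \<and> p \<in> W \<and> open V \<and> homeomorphism W V \<psi> \<psi>' \<and>
        C2_on \<psi> W \<and> C2_on \<psi>' V \<and> subspace L \<and> dim L = k \<and> \<psi> ` (M \<inter> W) = V \<inter> (L :: 'a set))"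

definition tangent_space :: "'a::euclidean_space set \<Rightarrow> 'a \<Rightarrow> 'a set" where
  "tangent_space M p = {v. \<exists>\<gamma> \<epsilon>. 0 < \<epsilon> \<and> (\<forall>t. \<bar>t\<bar> < \<epsilon> \<longrightarrow> \<gamma> t \<in> M) \<and> \<gamma> (0::real) = p \<and>
     (\<gamma> has_vector_derivative v) (at 0)}"

text \<open>The projection \<open>(\<cdot>)\<^sup>\<bottom>\<close> to the normal space of \<open>M\<close> at \<open>p\<close>.\<close>

definition normal_part :: "'a::euclidean_space set \<Rightarrow> 'a \<Rightarrow> 'a \<Rightarrow> 'a" where
  "normal_part M p v =
     (THE w. w \<in> orthogonal_comp (tangent_space M p) \<and> v - w \<in> tangent_space M p)"

text \<open>Vector fields along \<open>M\<close> are functions on the ambient space whose values off \<open>M\<close> are ignored.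
  Being \<open>C\<^sup>1\<close> along \<open>M\<close> means having local \<open>C\<^sup>1\<close> extensions to the ambient space.\<close>

definition C1_along :: "'a::euclidean_space set \<Rightarrow> ('a \<Rightarrow> 'a) \<Rightarrow> bool" where
  "C1_along M Y \<longleftrightarrow>
     (\<forall>p\<in>M. \<exists>W Z. open W \<and> p \<in> W \<and> C1_on Z W \<and> (\<forall>x\<in>M \<inter> W. Z x = Y x))"

text \<open>\<open>D\<^sub>u Y\<close> at \<open>p\<close> for a tangent vector \<open>u\<close>. A derivative within \<open>M\<close> is not unique as a linear map
  on the ambient space, but its values on tangent vectors are.\<close>

definition flat_deriv :: "'a::euclidean_space set \<Rightarrow> 'a \<Rightarrow> 'a \<Rightarrow> ('a \<Rightarrow> 'a) \<Rightarrow> 'a" where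
  "flat_deriv M p u Y = (THE w. \<exists>Y'. (Y has_derivative Y') (at p within M) \<and> w = Y' u)"

text \<open>\<open>B(u, v) = (D\<^sub>u Y)\<^sup>\<bottom>\<close> at \<open>p\<close>, for any local \<open>C\<^sup>1\<close> tangent field \<open>Y\<close> with \<open>Y(p) = v\<close>;
  the value does not depend on the choice of \<open>Y\<close>.\<close>

definition second_fundamental_form :: "'a::euclidean_space set \<Rightarrow> 'a \<Rightarrow> 'a \<Rightarrow> 'a \<Rightarrow> 'a" where
  "second_fundamental_form M p u v =
     (THE w. \<exists>Y W. open W \<and> p \<in> W \<and> C1_along (M \<inter> W) Y \<and>
        (\<forall>q\<in>M \<inter> W. Y q \<in> tangent_space M q) \<and> Y p = v \<and>
        w = normal_part M p (flat_deriv M p u Y))"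

text \<open>All expressions below are tensorial in the frame and independent of its choice, so a frame
  chosen separately at each point can be used in place of a local orthonormal frame field.\<close>

definition tangent_frame :: "'a::euclidean_space set \<Rightarrow> 'a \<Rightarrow> 'a set" where
  "tangent_frame M p =
     (SOME E. pairwise orthogonal E \<and> (\<forall>e\<in>E. norm e = 1) \<and> span E = tangent_space M p)"

definition mean_curvature :: "'a::euclidean_space set \<Rightarrow> 'a \<Rightarrow> 'a" where
  "mean_curvature M p = (\<Sum>e\<in>tangent_frame M p. second_fundamental_form M p e e)"


section \<open>Stationarity and stability\<close>

definition admissible_submanifold :: "nat \<Rightarrow> 'a::euclidean_space set \<Rightarrow> 'a set \<Rightarrow> bool" where
  "admissible_submanifold k U M \<longleftrightarrow>
     embedded_C2_submanifold k M \<and> U \<inter> M \<noteq> {} \<and> U \<inter> (closure M - M) = {}"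

text \<open>One-parameter families of \<open>C\<^sup>2\<close> diffeomorphisms of \<open>U\<close>, jointly \<open>C\<^sup>2\<close> in time and space,
  starting at the identity and equal to the identity off the compact set \<open>K\<close>.\<close>

definition deformation :: "'a::euclidean_space set \<Rightarrow> 'a set \<Rightarrow> (real \<Rightarrow> 'a \<Rightarrow> 'a) \<Rightarrow> bool" where
  "deformation U K \<phi> \<longleftrightarrow>
     compact K \<and> K \<subseteq> U \<and>
     C2_on (\<lambda>(t, x). \<phi> t x) ({-1<..<1} \<times> U) \<and>
     (\<forall>t\<in>{-1<..<1}. \<exists>\<psi>. homeomorphism U U (\<phi> t) \<psi> \<and> C2_on \<psi> U) \<and>
     (\<forall>x\<in>U. \<phi> 0 x = x) \<and>
     (\<forall>t\<in>{-1<..<1}. \<forall>x\<in>U - K. \<phi> t x = x)"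

text \<open>As usual, the first variation is computed on \<open>M \<inter> K\<close>, where everything is finite: the part of
  \<open>M\<close> off \<open>K\<close> is not moved, and its weighted volume may be infinite.\<close>

definition f_stationary ::
    "nat \<Rightarrow> 'a::euclidean_space set \<Rightarrow> ('a \<Rightarrow> real) \<Rightarrow> 'a set \<Rightarrow> bool" where
  "f_stationary k U f M \<longleftrightarrow>
     admissible_submanifold k U M \<and>
     (\<forall>K \<phi>. deformation U K \<phi> \<longrightarrow>
        ((\<lambda>t. weighted_volume k f (\<phi> t ` (M \<inter> K))) has_real_derivative 0) (at 0))"

definition normal_test_field :: "'a::euclidean_space set \<Rightarrow> 'a set \<Rightarrow> ('a \<Rightarrow> 'a) \<Rightarrow> bool" where
  "normal_test_field U M X \<longleftrightarrow>
     C1_along M X \<and> (\<forall>p\<in>M. X p \<in> orthogonal_comp (tangent_space M p)) \<and>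
     (\<exists>K. compact K \<and> K \<subseteq> M \<inter> U \<and> (\<forall>p\<in>M - K. X p = 0))"

text \<open>The integrals are taken over \<open>M \<inter> U\<close>, which contains the support of \<open>X\<close>; off \<open>U\<close> the Hessian
  of \<open>f\<close> need not exist.\<close>

definition f_stable ::
    "nat \<Rightarrow> 'a::euclidean_space set \<Rightarrow> ('a \<Rightarrow> real) \<Rightarrow> 'a set \<Rightarrow> bool" where
  "f_stable k U f M \<longleftrightarrow>
     f_stationary k U f M \<and>
     (\<forall>X. normal_test_field U M X \<longrightarrow>
        (LINT p:M \<inter> U|hausdorff_measure k.
           f p * ((\<Sum>u\<in>tangent_frame M p. \<Sum>v\<in>tangent_frame M p.
                     (second_fundamental_form M p u v \<bullet> X p)\<^sup>2)
                  + (mean_curvature M p \<bullet> X p)\<^sup>2))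
        \<le> (LINT p:M \<inter> U|hausdorff_measure k.
             f p * (\<Sum>u\<in>tangent_frame M p. (norm (normal_part M p (flat_deriv M p u X)))\<^sup>2)
             + Hess f p (X p) (X p)))"

end

theory Submission
  imports Defs
begin

text \<open>
  Let \<open>\<pi>\<close> be the orthogonal projection onto the plane \<open>P\<close>. Since \<open>f\<close> is radially nondecreasing,
  \<open>f (p + w) \<ge> f p\<close> for \<open>p \<in> P\<close> and \<open>w\<close> normal to \<open>P\<close>.

  Stationarity needs no area formula. Put \<open>A = P \<inter> K\<close>. For small \<open>t\<close> the map \<open>\<pi> \<circ> \<phi>\<^sub>t\<close> is a bijection of
  \<open>A\<close>, so \<open>\<phi>\<^sub>t(A)\<close> is a graph over \<open>A\<close>, and \<open>\<pi>\<close> restricted to it is 1-Lipschitz. Hence the weighted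
  volume of \<open>\<phi>\<^sub>t(A)\<close> is at least that of \<open>A\<close>. Conversely the graph map has Lipschitz constant
  \<open>1 + O(t\<^sup>2)\<close> by Pythagoras, and \<open>f\<close> changes by \<open>o(t)\<close> along it, because the normal derivatives of \<open>f\<close>
  vanish on \<open>P\<close>. So the weighted volume increases by at most \<open>o(t)\<close>.

  In the stability inequality the left-hand side vanishes because a plane is totally geodesic, while the
  integrand on the right is nonnegative: \<open>s \<mapsto> f (p + s X)\<close> has a minimum at \<open>s = 0\<close>.
\<close>

section \<open>Geometry of planes\<close>

text \<open>All properties follow from
  \<open>\<pi> x = (\<Sum>b\<in>B. (x \<bullet> b) *\<^sub>R b)\<close> for an orthonormal basis
  \<open>B\<close>. Basis and projection come in one package: coordinates serve to count cells in a
  cube of \<open>P\<close>, and \<open>\<pi>\<close> serves to compare a deformed plane with the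
  plane.\<close>

lemma orthonormal_projection:
  fixes P :: "'a::euclidean_space set"
  assumes "subspace P"
  obtains B \<pi> where "finite B" "card B = dim P" "B \<subseteq> P" "pairwise orthogonal B"
    "\<And>b. b \<in> B \<Longrightarrow> norm b = 1" "span B = P" "linear \<pi>" "\<And>x. \<pi> x \<in> P"
    "\<And>x. x \<in> P \<Longrightarrow> \<pi> x = x" "\<And>x y. y \<in> P \<Longrightarrow> (x - \<pi> x) \<bullet> y = 0"
    "\<And>x. norm (\<pi> x) \<le> norm x" "\<And>x. x \<in> P \<Longrightarrow> x = (\<Sum>b\<in>B. (x \<bullet> b) *\<^sub>R b)"
proof -
  obtain B where B: "B \<subseteq> P" "pairwise orthogonal B" "\<And>x. x \<in> B \<Longrightarrow> norm x = 1"
      "independent B" "card B = dim P" "span B = P"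
    using orthonormal_basis_subspace[OF assms] by metis
  have fin: "finite B" using B(4) by (rule independent_imp_finite)
  define \<pi> where "\<pi> x = (\<Sum>b\<in>B. (x \<bullet> b) *\<^sub>R b)" for x
  have lin: "linear \<pi>"
    by (rule linearI)
      (simp_all add: \<pi>_def inner_add_left scaleR_add_left sum.distrib scaleR_sum_right)
  have inP: "\<pi> x \<in> P" for x
    unfolding \<pi>_def using B(1) assms by (intro subspace_sum subspace_scale) auto
  have on: "b \<bullet> c = (if b = c then 1 else 0)" if "b \<in> B" "c \<in> B" for b c
    using that B(2,3) by (auto simp: pairwise_def orthogonal_def dot_square_norm)
  have "\<pi> x \<bullet> c = x \<bullet> c" if "c \<in> B" for x c
  proof -
    have "\<pi> x \<bullet> c = (\<Sum>b\<in>B. (x \<bullet> b) * (b \<bullet> c))" by (simp add: \<pi>_def inner_sum_left)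
    also have "\<dots> = (\<Sum>b\<in>B. if b = c then x \<bullet> b else 0)"
      using on that by (intro sum.cong) auto
    finally show ?thesis using fin that by simp
  qed
  then have "\<And>c. c \<in> B \<Longrightarrow> orthogonal (x - \<pi> x) c" for x
    by (simp add: orthogonal_def inner_diff_left)
  then have orth: "(x - \<pi> x) \<bullet> y = 0" if "y \<in> P" for x y
    using orthogonal_to_span[of y B "x - \<pi> x"] that B(6) by (auto simp: orthogonal_def)
  have pfix: "\<pi> x = x" if "x \<in> P" for x
  proof -
    have "x - \<pi> x \<in> P" using that inP assms by (intro subspace_diff)
    from orth[OF this, of x] show ?thesis by simp
  qed
  have "norm (\<pi> x) \<le> norm x" for x
  proof -
    have "(norm (\<pi> x))\<^sup>2 = x \<bullet> \<pi> x"
      using orth[OF inP[of x], of x] by (simp add: inner_diff_left dot_square_norm)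
    also have "\<dots> \<le> norm x * norm (\<pi> x)" by (rule norm_cauchy_schwarz)
    finally show ?thesis by (cases "norm (\<pi> x) = 0") (simp_all add: power2_eq_square)
  qed
  then show ?thesis
    using that[of B \<pi>] fin B lin inP pfix orth pfix[unfolded \<pi>_def, symmetric] by blast
qed

text \<open>Near 0 the curve equals its own projection, so its derivative is fixed by the linear map
  \<open>\<pi>\<close>. This is used both for tangent vectors and for derivatives of tangent
  fields.\<close>

lemma has_derivative_curve_in_subspace:
  fixes P :: "'a::euclidean_space set"
  assumes P: "subspace P" and "0 < \<epsilon>" and mem: "\<And>t. \<bar>t\<bar> < \<epsilon> \<Longrightarrow> \<gamma> t \<in> P"
    and \<gamma>: "(\<gamma> has_vector_derivative v) (at (0::real))"
  shows "v \<in> P"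
proof -
  obtain \<pi> where \<pi>: "linear \<pi>" "\<And>x. \<pi> x \<in> P" "\<And>x. x \<in> P \<Longrightarrow> \<pi> x = x"
    by (rule orthonormal_projection[OF P]) (rule that)
  have "((\<lambda>t. \<pi> (\<gamma> t)) has_vector_derivative \<pi> v) (at 0)"
    using bounded_linear.has_vector_derivative[OF _ \<gamma>] \<pi>(1) by (simp add: linear_conv_bounded_linear)
  then have "(\<gamma> has_vector_derivative \<pi> v) (at 0)"
    by (rule has_vector_derivative_transform_within[where d = \<epsilon>])
      (use assms \<pi> in \<open>auto simp: dist_real_def\<close>)
  then have "\<pi> v = v" using \<gamma> by (rule vector_derivative_unique_at)
  then show ?thesis using \<pi>(2)[of v] by simp
qed

lemma tangent_space_subspace:
  fixes P :: "'a::euclidean_space set"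
  assumes "subspace P" "p \<in> P"
  shows "tangent_space P p = P"
proof
  show "tangent_space P p \<subseteq> P"
    using has_derivative_curve_in_subspace[OF assms(1)] by (auto simp: tangent_space_def)
  show "P \<subseteq> tangent_space P p"
  proof
    fix v assume "v \<in> P"
    moreover have "((\<lambda>t. p + t *\<^sub>R v) has_vector_derivative v) (at 0)"
      by (auto intro!: derivative_eq_intros)
    ultimately show "v \<in> tangent_space P p"
      using assms unfolding tangent_space_def
      by (intro CollectI exI[of _ "\<lambda>t. p + t *\<^sub>R v"] exI[of _ 1])
        (auto intro: subspace_add subspace_scale)
  qed
qed

lemma normal_part_subspace:
  fixes P :: "'a::euclidean_space set"
  assumes P: "subspace P" "p \<in> P" and v: "v \<in> P"
  shows "normal_part P p v = 0"
  unfolding normal_part_def tangent_space_subspace[OF P]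
proof (rule the_equality)
  show "0 \<in> orthogonal_comp P \<and> v - 0 \<in> P"
    using v by (simp add: orthogonal_comp_def orthogonal_def)
  fix w assume w: "w \<in> orthogonal_comp P \<and> v - w \<in> P"
  then have "v - (v - w) \<in> P" using P v by (intro subspace_diff[of P v "v - w"]) auto
  then have "w \<in> P" by simp
  with w have "w \<bullet> w = 0" unfolding orthogonal_comp_def orthogonal_def by blast
  then show "w = 0" by simp
qed

text \<open>Any derivative of \<open>Y\<close> within \<open>P\<close> gives, at
  \<open>u \<in> P\<close>, the derivative of \<open>Y\<close> along the line
  \<open>p + t *\<^sub>R u\<close>, which stays in \<open>P\<close>. Hence the definite description
  in \<open>flat_deriv\<close> is well defined.\<close>

lemma flat_deriv_subspace:
  fixes P :: "'a::euclidean_space set"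
  assumes P: "subspace P" "p \<in> P" and u: "u \<in> P" and Y: "(Y has_derivative Y') (at p within P)"
  shows "flat_deriv P p u Y = Y' u"
    and "((\<lambda>t. Y (p + t *\<^sub>R u)) has_vector_derivative Y' u) (at 0)"
proof -
  have *: "((\<lambda>t. Y (p + t *\<^sub>R u)) has_vector_derivative Z' u) (at 0)"
    if "(Y has_derivative Z') (at p within P)" for Z'
  proof -
    have "((\<lambda>t. p + t *\<^sub>R u) has_vector_derivative u) (at (0::real))"
      by (auto intro!: derivative_eq_intros)
    moreover have "(Y has_derivative Z') (at (p + 0 *\<^sub>R u) within range (\<lambda>t. p + t *\<^sub>R u))"
      using P u that by (auto intro: has_derivative_subset subspace_add subspace_scale)
    ultimately show ?thesis
      using vector_derivative_diff_chain_within[of "\<lambda>t. p + t *\<^sub>R u" u 0 UNIV Y Z']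
      by (simp add: o_def)
  qed
  show "((\<lambda>t. Y (p + t *\<^sub>R u)) has_vector_derivative Y' u) (at 0)" using Y by (rule *)
  show "flat_deriv P p u Y = Y' u"
    unfolding flat_deriv_def
  proof (rule the_equality)
    show "\<exists>Z'. (Y has_derivative Z') (at p within P) \<and> Y' u = Z' u" using Y by blast
    fix w assume "\<exists>Z'. (Y has_derivative Z') (at p within P) \<and> w = Z' u"
    then obtain Z' where "(Y has_derivative Z') (at p within P)" "w = Z' u" by blast
    then show "w = Y' u" using vector_derivative_unique_at[OF * *[OF Y]] by blast
  qed
qed

section \<open>Extrinsic curvature of a plane\<close>

lemma C1_on_const: "C1_on (\<lambda>_. c) S"
  unfolding C1_on_def by (intro exI[of _ "\<lambda>_. 0"]) (auto simp: zero_blinfun.rep_eq)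

text \<open>The constant field \<open>v\<close> shows that 0 is a value. It is the only one: a
  tangent field takes values in \<open>P\<close> along a line in \<open>P\<close>, so its derivative
  lies in \<open>P\<close> and has no normal part.\<close>

lemma second_fundamental_form_subspace:
  fixes P :: "'a::euclidean_space set"
  assumes P: "subspace P" "p \<in> P" and u: "u \<in> P" and v: "v \<in> P"
  shows "second_fundamental_form P p u v = 0"
  unfolding second_fundamental_form_def
proof (rule the_equality)
  have "C1_along (P \<inter> UNIV) (\<lambda>_. v)"
    unfolding C1_along_def using C1_on_const by blast
  moreover have "flat_deriv P p u (\<lambda>_. v) = 0"
    using flat_deriv_subspace(1)[OF P u has_derivative_const] .
  moreover have "0 \<in> P" using P by (simp add: subspace_0)
  ultimately show "\<exists>Y W. open W \<and> p \<in> W \<and> C1_along (P \<inter> W) Y \<and>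
      (\<forall>q\<in>P \<inter> W. Y q \<in> tangent_space P q) \<and> Y p = v \<and> 0 = normal_part P p (flat_deriv P p u Y)"
    using v by (intro exI[of _ "\<lambda>_. v"] exI[of _ UNIV])
      (auto simp: tangent_space_subspace[OF P(1)] normal_part_subspace[OF P])
  fix w assume "\<exists>Y W. open W \<and> p \<in> W \<and> C1_along (P \<inter> W) Y \<and>
      (\<forall>q\<in>P \<inter> W. Y q \<in> tangent_space P q) \<and> Y p = v \<and> w = normal_part P p (flat_deriv P p u Y)"
  then obtain Y W where YW: "open W \<and> p \<in> W \<and> C1_along (P \<inter> W) Y \<and>
      (\<forall>q\<in>P \<inter> W. Y q \<in> tangent_space P q) \<and> Y p = v \<and> w = normal_part P p (flat_deriv P p u Y)"
    by (elim exE) (rule that)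
  then have W: "open W" "p \<in> W" "C1_along (P \<inter> W) Y"
    and tan': "\<forall>q\<in>P \<inter> W. Y q \<in> tangent_space P q"
    and w: "w = normal_part P p (flat_deriv P p u Y)"
    by simp_all
  have tan: "Y q \<in> P" if "q \<in> P \<inter> W" for q
    using tan' that tangent_space_subspace[OF P(1), of q] by blast
  have "p \<in> P \<inter> W" using P(2) W(2) by simp
  from bspec[OF W(3)[unfolded C1_along_def] this]
  obtain V Z where "open V \<and> p \<in> V \<and> C1_on Z V \<and> (\<forall>x\<in>P \<inter> W \<inter> V. Z x = Y x)"
    by (elim exE) (rule that)
  then have V: "open V" "p \<in> V" "C1_on Z V" "\<And>x. x \<in> P \<inter> W \<inter> V \<Longrightarrow> Z x = Y x"
    by simp_all
  \<comment> \<open>\<open>Y\<close> itself is controlled only on \<open>P\<close>, so the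
    derivative is taken from the local extension \<open>Z\<close> and transferred to
    \<open>Y\<close> within \<open>P\<close> on a small ball.\<close>
  obtain \<epsilon> where \<epsilon>: "\<epsilon> > 0" "ball p \<epsilon> \<subseteq> W \<inter> V"
    using W V by (metis IntI open_Int openE)
  obtain Z' where "(Z has_derivative Z') (at p)" using V unfolding C1_on_def by blast
  then have "(Z has_derivative Z') (at p within P)" by (rule has_derivative_at_withinI)
  then have Y: "(Y has_derivative Z') (at p within P)"
    by (rule has_derivative_transform_within[where d = \<epsilon>])
      (use \<epsilon> P V(4) in \<open>auto simp: subset_iff dist_commute\<close>)
  \<comment> \<open>This keeps \<open>p + t *\<^sub>R u\<close> in the ball; the summand 1 covers
    \<open>u = 0\<close>.\<close>
  define \<delta> where "\<delta> = \<epsilon> / (norm u + 1)"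
  have "\<delta> > 0" using \<epsilon> by (simp add: \<delta>_def add_nonneg_pos)
  have "Y (p + t *\<^sub>R u) \<in> P" if "\<bar>t\<bar> < \<delta>" for t
  proof -
    have "\<bar>t\<bar> * norm u \<le> \<bar>t\<bar> * (norm u + 1)" by (intro mult_left_mono) auto
    also have "\<dots> < \<epsilon>" using that by (simp add: \<delta>_def pos_less_divide_eq add_nonneg_pos)
    finally have "p + t *\<^sub>R u \<in> ball p \<epsilon>" by (simp add: dist_norm)
    then show ?thesis using \<epsilon> P u by (intro tan) (auto intro: subspace_add subspace_scale)
  qed
  from has_derivative_curve_in_subspace[OF P(1) \<open>\<delta> > 0\<close> this flat_deriv_subspace(2)[OF P u Y]]
  show "w = 0" by (simp add: w flat_deriv_subspace(1)[OF P u Y] normal_part_subspace[OF P])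
qed

lemma tangent_frame_subspace:
  fixes P :: "'a::euclidean_space set"
  assumes "subspace P" "p \<in> P"
  shows "tangent_frame P p \<subseteq> P"
proof -
  obtain B where B: "pairwise orthogonal B" "\<And>b. b \<in> B \<Longrightarrow> norm b = 1" "span B = P"
    by (rule orthonormal_projection[OF assms(1)]) (rule that)
  have "span (tangent_frame P p) = P"
    unfolding tangent_frame_def tangent_space_subspace[OF assms]
    by (rule someI2[of _ B]) (use B in auto)
  then show ?thesis using span_superset by blast
qed

lemma mean_curvature_subspace:
  fixes P :: "'a::euclidean_space set"
  assumes "subspace P" "p \<in> P"
  shows "mean_curvature P p = 0"
  unfolding mean_curvature_def
  using tangent_frame_subspace[OF assms] second_fundamental_form_subspace[OF assms]
  by (intro sum.neutral) blast

lemma C2_on_ident: "C2_on (\<lambda>x. x) S"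
  unfolding C2_on_def by (intro exI[of _ "\<lambda>_. id_blinfun"]) (auto simp: C1_on_const)

lemma admissible_subspace:
  fixes P U :: "'a::euclidean_space set"
  assumes "subspace P" "U \<inter> P \<noteq> {}"
  shows "admissible_submanifold (dim P) U P"
proof -
  have "homeomorphism UNIV UNIV (\<lambda>x. x :: 'a) (\<lambda>x. x)"
    by (simp add: homeomorphism_def)
  moreover have "(\<lambda>x. x :: 'a) ` (P \<inter> UNIV) = UNIV \<inter> P" by auto
  ultimately have "embedded_C2_submanifold (dim P) P"
    unfolding embedded_C2_submanifold_def using assms(1) C2_on_ident by blast
  moreover have "closure P = P" using assms(1) by (simp add: closed_subspace)
  ultimately show ?thesis using assms(2) by (simp add: admissible_submanifold_def)
qed

section \<open>Hausdorff measure and Lipschitz maps\<close>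

text \<open>A cover of \<open>S\<close> is pushed forward by \<open>h\<close>: diameters grow at
  most by the factor \<open>L\<close>, hence gauges by \<open>L ^ k\<close>, and the scale
  \<open>\<delta>\<close> becomes \<open>L * \<delta>\<close>.\<close>

lemma hausdorff_pre_lipschitz:
  fixes S :: "'a::euclidean_space set" and h :: "'a \<Rightarrow> 'b::euclidean_space"
  assumes L: "0 < L" and lip: "\<And>x y. x \<in> S \<Longrightarrow> y \<in> S \<Longrightarrow> dist (h x) (h y) \<le> L * dist x y"
  shows "hausdorff_pre k (L * \<delta>) (h ` S) \<le> ennreal (L ^ k) * hausdorff_pre k \<delta> S"
proof -
  have *: "hausdorff_pre k (L * \<delta>) (h ` S) \<le> ennreal (L ^ k) * (\<Sum>i. hausdorff_gauge k (C i))"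
    if C: "S \<subseteq> (\<Union>i. C i)" "\<And>i. bounded (C i) \<and> diameter (C i) \<le> \<delta>" for C :: "nat \<Rightarrow> 'a set"
  proof -
    \<comment> \<open>The intersection with \<open>S\<close> is taken because \<open>h\<close> is
      Lipschitz only there.\<close>
    define D where "D i = h ` (C i \<inter> S)" for i
    have dD: "diameter (D i) \<le> L * diameter (C i)" for i
    proof (rule diameter_le)
      show "D i \<noteq> {} \<or> 0 \<le> L * diameter (C i)"
        using L C(2)[of i] by (simp add: diameter_ge_0)
      fix x y assume "x \<in> D i" "y \<in> D i"
      then obtain u v where uv: "u \<in> C i \<inter> S" "v \<in> C i \<inter> S" "x = h u" "y = h v"
        by (auto simp: D_def)
      have "dist x y \<le> L * dist u v" using uv lip by auto
      also have "\<dots> \<le> L * diameter (C i)"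
        using uv C(2)[of i] L by (auto intro!: mult_left_mono diameter_bounded_bound)
      finally show "norm (x - y) \<le> L * diameter (C i)" by (simp add: dist_norm)
    qed
    \<comment> \<open>The diameter of an unbounded set is a meaningless real, so boundedness of the
      new cover is established on its own.\<close>
    have bD: "bounded (D i)" for i
    proof (cases "C i \<inter> S = {}")
      case False
      then obtain u where u: "u \<in> C i \<inter> S" by auto
      have "dist (h u) y \<le> L * diameter (C i)" if y: "y \<in> D i" for y
      proof -
        obtain v where v: "v \<in> C i \<inter> S" "y = h v" using y by (auto simp: D_def)
        have "dist (h u) y \<le> L * dist u v" using u v lip by auto
        also have "\<dots> \<le> L * diameter (C i)"
          using u v C(2)[of i] L by (auto intro!: mult_left_mono diameter_bounded_bound)
        finally show ?thesis .
      qed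
      then show ?thesis unfolding bounded_def by blast
    qed (simp add: D_def)
    have "hausdorff_pre k (L * \<delta>) (h ` S) \<le> (\<Sum>i. hausdorff_gauge k (D i))"
      unfolding hausdorff_pre_def
    proof (rule INF_lower, intro CollectI conjI allI)
      show "h ` S \<subseteq> (\<Union>i. D i)" using C(1) by (fastforce simp: D_def)
      fix i
      show "bounded (D i)" by (rule bD)
      have "L * diameter (C i) \<le> L * \<delta>" using C(2)[of i] L by auto
      then show "diameter (D i) \<le> L * \<delta>" using dD[of i] by linarith
    qed
    also have "\<dots> \<le> (\<Sum>i. ennreal (L ^ k) * hausdorff_gauge k (C i))"
    proof (rule suminf_le)
      fix i
      show "hausdorff_gauge k (D i) \<le> ennreal (L ^ k) * hausdorff_gauge k (C i)"
      proof (cases "D i = {}")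
        case False
        then have "C i \<noteq> {}" by (auto simp: D_def)
        have "(diameter (D i) / 2) ^ k \<le> (L * (diameter (C i) / 2)) ^ k"
          using dD[of i] bD[of i] by (intro power_mono) (auto simp: diameter_ge_0)
        then have "unit_ball_vol (real k) * (diameter (D i) / 2) ^ k
            \<le> L ^ k * (unit_ball_vol (real k) * (diameter (C i) / 2) ^ k)"
          by (simp only: power_mult_distrib mult.left_commute[of "L ^ k"])
            (rule mult_left_mono, simp_all)
        from ennreal_leI[OF this] show ?thesis
          using False \<open>C i \<noteq> {}\<close> L by (simp add: hausdorff_gauge_def flip: ennreal_mult')
      qed (simp add: hausdorff_gauge_def)
    qed auto
    finally show ?thesis by simp
  qed
  \<comment> \<open>With the factor divided out, the claim is a lower bound for an infimum and can
    be checked cover by cover.\<close>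
  have "hausdorff_pre k (L * \<delta>) (h ` S) / ennreal (L ^ k) \<le> hausdorff_pre k \<delta> S"
    unfolding hausdorff_pre_def[of k \<delta> S]
  proof (rule INF_greatest)
    fix C :: "nat \<Rightarrow> 'a set"
    assume "C \<in> {C. S \<subseteq> (\<Union>i. C i) \<and> (\<forall>i. bounded (C i) \<and> diameter (C i) \<le> \<delta>)}"
    then have "hausdorff_pre k (L * \<delta>) (h ` S) \<le> ennreal (L ^ k) * (\<Sum>i. hausdorff_gauge k (C i))"
      by (intro *) auto
    from divide_right_mono_ennreal[OF this, of "ennreal (L ^ k)"]
    show "hausdorff_pre k (L * \<delta>) (h ` S) / ennreal (L ^ k) \<le> (\<Sum>i. hausdorff_gauge k (C i))"
      using L by (simp add: mult.commute[of "ennreal _"] ennreal_mult_divide_eq)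
  qed
  from mult_left_mono[OF this, of "ennreal (L ^ k)"] show ?thesis
    using L by (simp add: ennreal_times_divide mult.commute[of "ennreal _"] ennreal_mult_divide_eq)
qed

text \<open>Scale \<open>\<delta>\<close> in the image corresponds to scale
  \<open>\<delta> / L\<close> in \<open>S\<close>, and the supremum over all scales absorbs the
  change.\<close>

lemma hausdorff_outer_lipschitz:
  fixes S :: "'a::euclidean_space set" and h :: "'a \<Rightarrow> 'b::euclidean_space"
  assumes L: "0 < L" and lip: "\<And>x y. x \<in> S \<Longrightarrow> y \<in> S \<Longrightarrow> dist (h x) (h y) \<le> L * dist x y"
  shows "hausdorff_outer k (h ` S) \<le> ennreal (L ^ k) * hausdorff_outer k S"
  unfolding hausdorff_outer_def[of k "h ` S"]
proof (rule SUP_least)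
  fix \<delta> :: real assume "\<delta> \<in> {0<..}"
  then have "hausdorff_pre k (\<delta> / L) S \<le> hausdorff_outer k S"
    unfolding hausdorff_outer_def using L by (intro SUP_upper) auto
  then show "hausdorff_pre k \<delta> (h ` S) \<le> ennreal (L ^ k) * hausdorff_outer k S"
    using hausdorff_pre_lipschitz[of L S h k "\<delta> / L"] L lip
    by (fastforce intro: order_trans mult_left_mono)
qed

text \<open>In orthonormal coordinates \<open>S\<close> lies in a cube of side \<open>2 * R\<close>.
  Cutting it into \<open>(2 * N) ^ k\<close> equal cells gives covers of arbitrarily small mesh
  whose total gauge is bounded independently of \<open>N\<close>.\<close>

lemma hausdorff_outer_bounded_subspace_finite:
  fixes P S :: "'a::euclidean_space set"
  assumes "subspace P" "dim P = k" "S \<subseteq> P" "bounded S"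
  shows "hausdorff_outer k S < \<infinity>"
proof -
  obtain B where B: "finite B" "card B = dim P" "\<And>b. b \<in> B \<Longrightarrow> norm b = 1"
      "\<And>x. x \<in> P \<Longrightarrow> x = (\<Sum>b\<in>B. (x \<bullet> b) *\<^sub>R b)"
    by (rule orthonormal_projection[OF assms(1)]) (rule that)
  obtain R where R: "R > 0" "\<And>x. x \<in> S \<Longrightarrow> norm x < R"
    using \<open>bounded S\<close> unfolding bounded_pos_less by metis
  have "hausdorff_pre k \<delta> S \<le> ennreal (unit_ball_vol (real k) * (k * R) ^ k)" if "\<delta> > 0" for \<delta>
  proof -
    \<comment> \<open>\<open>k * R / N\<close> will bound the diameter of a cell, as the sum of its
      \<open>k\<close> side lengths.\<close>
    obtain N :: nat where N: "real N > k * R / \<delta>" using reals_Archimedean2 by blast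
    have "k * R / \<delta> \<ge> 0" using R that by simp
    with N have N0: "N > 0" by (cases N) auto
    have N\<delta>: "k * R / N \<le> \<delta>" using N N0 that by (simp add: field_simps)
    define J where "J = B \<rightarrow>\<^sub>E {..<2 * N}"
    have J: "finite J" "card J = (2 * N) ^ k"
      using B assms(2) by (auto simp: J_def card_PiE intro!: finite_PiE)
    \<comment> \<open>Each coordinate range from \<open>-R\<close> to \<open>R\<close> is cut into
      \<open>2 * N\<close> closed intervals of length \<open>R / N\<close>, and \<open>j\<close>
      records the interval for each basis vector. Overlaps of neighbouring cells are harmless for a
      cover.\<close>
    define cell where "cell j = {x \<in> P. \<forall>b\<in>B. j b \<le> (x \<bullet> b + R) * N / R \<and> (x \<bullet> b + R) * N / R \<le> j b + 1}"
      for j :: "'a \<Rightarrow> nat"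
    have cd: "norm (x - y) \<le> k * R / N" if "x \<in> cell j" "y \<in> cell j" for x y j
    proof -
      have "x - y \<in> P" using that assms(1) by (auto simp: cell_def intro: subspace_diff)
      from B(4)[OF this] have "norm (x - y) \<le> (\<Sum>b\<in>B. norm (((x - y) \<bullet> b) *\<^sub>R b))"
        by (metis norm_sum)
      also have "\<dots> \<le> (\<Sum>b\<in>B. R / N)"
      proof (rule sum_mono)
        fix b assume b: "b \<in> B"
        have "\<bar>(x \<bullet> b + R) * N / R - (y \<bullet> b + R) * N / R\<bar> \<le> 1"
        proof -
          have "j b \<le> (x \<bullet> b + R) * N / R" "(x \<bullet> b + R) * N / R \<le> j b + 1"
            "j b \<le> (y \<bullet> b + R) * N / R" "(y \<bullet> b + R) * N / R \<le> j b + 1"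
            using that b unfolding cell_def by blast+
          then show ?thesis by linarith
        qed
        also have "(x \<bullet> b + R) * N / R - (y \<bullet> b + R) * N / R = ((x - y) \<bullet> b) * (N / R)"
          using R N0 by (simp add: field_simps inner_diff_left)
        finally have "\<bar>(x - y) \<bullet> b\<bar> * (N / R) \<le> 1" using R by (simp add: abs_mult)
        then show "norm (((x - y) \<bullet> b) *\<^sub>R b) \<le> R / N"
          using R N0 B(3)[OF b] by (simp add: field_simps)
      qed
      finally show ?thesis using B assms(2) by simp
    qed
    have cb: "bounded (cell j)" for j
    proof (cases "cell j = {}")
      case False
      then obtain u where "u \<in> cell j" by auto
      then show ?thesis unfolding bounded_def dist_norm using cd by blast
    qed simp
    have cD: "diameter (cell j) \<le> k * R / N" for j
      using cd R by (intro diameter_le) auto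
    have cov: "\<exists>j\<in>J. x \<in> cell j" if "x \<in> S" for x
    proof -
      define j where "j = restrict (\<lambda>b. nat \<lfloor>(x \<bullet> b + R) * N / R\<rfloor>) B"
      have r: "0 \<le> (x \<bullet> b + R) * N / R" "(x \<bullet> b + R) * N / R < 2 * N" if "b \<in> B" for b
      proof -
        have "\<bar>x \<bullet> b\<bar> \<le> norm x * norm b" by (rule Cauchy_Schwarz_ineq2)
        then have "\<bar>x \<bullet> b\<bar> < R" using R(2)[OF \<open>x \<in> S\<close>] B(3)[OF that] by simp
        then have "0 \<le> x \<bullet> b + R" "x \<bullet> b + R < 2 * R" by auto
        then show "0 \<le> (x \<bullet> b + R) * N / R" "(x \<bullet> b + R) * N / R < 2 * N"
          using R(1) N0 by (simp_all add: divide_less_eq)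
      qed
      have "j \<in> J" unfolding J_def j_def
        using r by (auto simp: nat_less_iff floor_less_iff)
      moreover have "y \<le> 1 + real_of_int \<lfloor>y\<rfloor>" for y :: real by linarith
      then have "x \<in> cell j"
        using \<open>x \<in> S\<close> assms(3) r by (auto simp: cell_def j_def)
      ultimately show ?thesis by blast
    qed
    obtain h where h: "bij_betw h {0..<card J} J" using ex_bij_betw_nat_finite[OF J(1)] by blast
    \<comment> \<open>The finite family is padded to a sequence by empty sets, whose gauge is 0 for
      every \<open>k\<close>, including \<open>k = 0\<close>.\<close>
    define C where "C i = (if i < card J then cell (h i) else {})" for i
    have "hausdorff_pre k \<delta> S \<le> (\<Sum>i. hausdorff_gauge k (C i))"
      unfolding hausdorff_pre_def
    proof (rule INF_lower, intro CollectI conjI allI)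
      show "S \<subseteq> (\<Union>i. C i)"
      proof
        fix x assume "x \<in> S"
        then obtain j where "j \<in> J" "x \<in> cell j" using cov by blast
        moreover then obtain i where "i < card J" "h i = j"
          using bij_betw_imp_surj_on[OF h] by force
        ultimately show "x \<in> (\<Union>i. C i)" by (auto simp: C_def intro!: exI[of _ i])
      qed
      fix i
      show "bounded (C i)" using cb by (simp add: C_def)
      show "diameter (C i) \<le> \<delta>" using cD[of "h i"] N\<delta> that by (auto simp: C_def)
    qed
    also have "\<dots> = (\<Sum>i<card J. hausdorff_gauge k (C i))"
      by (rule suminf_finite) (auto simp: C_def hausdorff_gauge_def)
    also have "\<dots> \<le> (\<Sum>i<card J. ennreal (unit_ball_vol (real k) * (k * R / N / 2) ^ k))"
    proof (rule sum_mono)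
      fix i
      show "hausdorff_gauge k (C i) \<le> ennreal (unit_ball_vol (real k) * (k * R / N / 2) ^ k)"
        using cD[of "h i"] cb[of "h i"]
        by (auto simp: hausdorff_gauge_def C_def diameter_ge_0
            intro!: ennreal_leI mult_left_mono power_mono)
    qed
    \<comment> \<open>The number of cells cancels the power of \<open>N\<close> in the gauge, so the
      final bound does not depend on the scale \<open>\<delta>\<close>.\<close>
    also have "\<dots> = ennreal (real (2 * N) ^ k * (unit_ball_vol (real k) * (k * R / N / 2) ^ k))"
      using R by (simp add: J ennreal_of_nat_eq_real_of_nat ennreal_mult' flip: ennreal_power)
    also have "real (2 * N) ^ k * (unit_ball_vol (real k) * (k * R / N / 2) ^ k)
        = unit_ball_vol (real k) * (real (2 * N) * (k * R / N / 2)) ^ k"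
      by (simp only: power_mult_distrib[of "real (2 * N)"] mult.left_commute)
    also have "real (2 * N) * (k * R / N / 2) = k * R" using N0 by simp
    finally show ?thesis .
  qed
  then have "hausdorff_outer k S \<le> ennreal (unit_ball_vol (real k) * (k * R) ^ k)"
    unfolding hausdorff_outer_def by (intro SUP_least) auto
  then show ?thesis by (simp add: order_le_less_trans ennreal_less_top)
qed

section \<open>Hausdorff measure on Borel sets\<close>

lemma sets_hausdorff_measure [simp, measurable_cong]: "sets (hausdorff_measure k) = sets borel"
  by (metis hausdorff_measure_def sets.sets_measure_of_eq space_borel)

lemma space_hausdorff_measure [simp]: "space (hausdorff_measure k) = UNIV"
  by (simp add: hausdorff_measure_def)

text \<open>If the outer measure were not countably additive on Borel sets, \<^const>\<open>measure_of\<close> would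
  return the zero measure. All that is used of Hausdorff measure, the behaviour under Lipschitz maps and
  the finiteness on bounded pieces of a plane, holds in this case as well.\<close>

lemma emeasure_hausdorff_measure_cases:
  "(\<forall>S\<in>sets borel. emeasure (hausdorff_measure k) S = hausdorff_outer k (S :: 'a::euclidean_space set)) \<or>
   (\<forall>S :: 'a set. emeasure (hausdorff_measure k) S = 0)"
  unfolding hausdorff_measure_def emeasure_measure_of_conv
  by (metis sets.sigma_sets_eq space_borel)

lemma emeasure_hausdorff_measure_lipschitz:
  fixes S :: "'a::euclidean_space set" and h :: "'a \<Rightarrow> 'a"
  assumes "S \<in> sets borel" "h ` S \<in> sets borel" "0 < L"
    and "\<And>x y. x \<in> S \<Longrightarrow> y \<in> S \<Longrightarrow> dist (h x) (h y) \<le> L * dist x y"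
  shows "emeasure (hausdorff_measure k) (h ` S) \<le> ennreal (L ^ k) * emeasure (hausdorff_measure k) S"
  using emeasure_hausdorff_measure_cases[of k, where 'a = 'a]
proof
  assume "\<forall>S :: 'a set\<in>sets borel. emeasure (hausdorff_measure k) S = hausdorff_outer k S"
  then show ?thesis using assms hausdorff_outer_lipschitz[of L S h k] by simp
qed simp

lemma emeasure_hausdorff_measure_bounded_subspace_finite:
  fixes P S :: "'a::euclidean_space set"
  assumes "subspace P" "dim P = k" "S \<subseteq> P" "bounded S" "S \<in> sets borel"
  shows "emeasure (hausdorff_measure k) S < \<infinity>"
  using emeasure_hausdorff_measure_cases[of k, where 'a = 'a]
proof
  assume "\<forall>S :: 'a set\<in>sets borel. emeasure (hausdorff_measure k) S = hausdorff_outer k S"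
  then show ?thesis using assms hausdorff_outer_bounded_subspace_finite[of P k S] by simp
qed simp

section \<open>Weighted volume of a graph over a compact set\<close>

lemma borel_measurable_ennreal_indicator:
  fixes f :: "'a::euclidean_space \<Rightarrow> real"
  assumes "compact M" "continuous_on M f"
  shows "(\<lambda>x. ennreal (f x) * indicator M x) \<in> borel_measurable borel"
proof -
  have "(\<lambda>x. indicator M x *\<^sub>R f x) \<in> borel_measurable borel"
    using assms by (intro borel_measurable_continuous_on_indicator borel_compact) auto
  then have "(\<lambda>x. ennreal (indicator M x *\<^sub>R f x)) \<in> borel_measurable borel" by measurable
  also have "(\<lambda>x. ennreal (indicator M x *\<^sub>R f x)) = (\<lambda>x. ennreal (f x) * indicator M x)"
    by (auto simp: indicator_def)
  finally show ?thesis .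
qed

text \<open>When the integral diverges both sides are 0, so the identity holds without
  integrability; finiteness has to be supplied wherever monotonicity is wanted.\<close>

lemma weighted_volume_eq_nn_integral:
  fixes f :: "'a::euclidean_space \<Rightarrow> real"
  assumes "compact M" "continuous_on M f" "\<And>x. x \<in> M \<Longrightarrow> 0 \<le> f x"
  shows "weighted_volume k f M = enn2real (\<integral>\<^sup>+x. ennreal (f x) * indicator M x \<partial>hausdorff_measure k)"
proof -
  have "(\<lambda>x. indicator M x *\<^sub>R f x) \<in> borel_measurable borel"
    using assms by (intro borel_measurable_continuous_on_indicator borel_compact) auto
  then have "weighted_volume k f M = enn2real (\<integral>\<^sup>+x. ennreal (indicator M x *\<^sub>R f x) \<partial>hausdorff_measure k)"
    unfolding weighted_volume_def set_lebesgue_integral_def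
    using assms(3) by (intro integral_eq_nn_integral) (auto simp: indicator_def)
  also have "(\<lambda>x. ennreal (indicator M x *\<^sub>R f x)) = (\<lambda>x. ennreal (f x) * indicator M x)"
    by (auto simp: indicator_def)
  finally show ?thesis .
qed

text \<open>This replaces the area formula. \<open>B\<close> is a graph over \<open>A\<close>, the
  projection to \<open>A\<close> is 1-Lipschitz and its inverse is \<open>L\<close>-Lipschitz. So
  the measure on \<open>A\<close> and the push-forward of the measure on \<open>B\<close> dominate
  each other up to the factor \<open>L ^ k\<close>, and it remains to integrate over both.\<close>

lemma weighted_volume_projection_bounds:
  fixes f :: "'a::euclidean_space \<Rightarrow> real" and \<pi> :: "'a \<Rightarrow> 'a"
  assumes B: "compact B" and A: "A = \<pi> ` B"
    and nonexp: "\<And>x y. dist (\<pi> x) (\<pi> y) \<le> dist x y"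
    and L: "0 < L" and exp: "\<And>x y. x \<in> B \<Longrightarrow> y \<in> B \<Longrightarrow> dist x y \<le> L * dist (\<pi> x) (\<pi> y)"
    and contA: "continuous_on A f" and contB: "continuous_on B f"
    and f0: "\<And>x. x \<in> A \<Longrightarrow> 0 \<le> f x" and e: "0 \<le> e"
    and lower: "\<And>x. x \<in> B \<Longrightarrow> f (\<pi> x) \<le> f x" and upper: "\<And>x. x \<in> B \<Longrightarrow> f x \<le> f (\<pi> x) + e"
    and fin: "emeasure (hausdorff_measure k) A < \<infinity>"
  shows "weighted_volume k f A \<le> weighted_volume k f B"
    and "weighted_volume k f B \<le> L ^ k * (weighted_volume k f A + e * measure (hausdorff_measure k) A)"
proof -
  let ?H = "hausdorff_measure k :: 'a measure"
  have cont: "continuous_on UNIV \<pi>"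
  proof (rule lipschitz_on_continuous_on)
    show "1-lipschitz_on UNIV \<pi>" using nonexp by (auto intro: lipschitz_onI)
  qed
  then have \<pi>[measurable]: "\<pi> \<in> borel_measurable borel"
    by (rule borel_measurable_continuous_onI)
  have cA: "compact A" unfolding A using cont B continuous_on_subset by (intro compact_continuous_image) auto
  have [measurable]: "A \<in> sets borel" "B \<in> sets borel" using cA B by (auto intro: borel_compact)
  define F where "F x = ennreal (f x) * indicator A x" for x
  have [measurable]: "F \<in> borel_measurable borel"
    unfolding F_def using cA contA by (rule borel_measurable_ennreal_indicator)
  define IA where "IA = (\<integral>\<^sup>+x. F x \<partial>?H)"
  define IB where "IB = (\<integral>\<^sup>+x. ennreal (f x) * indicator B x \<partial>?H)"
  have fB: "0 \<le> f x" if "x \<in> B" for x using lower[OF that] f0[of "\<pi> x"] that A by auto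
  have WA: "weighted_volume k f A = enn2real IA"
    unfolding IA_def F_def using cA contA f0 by (rule weighted_volume_eq_nn_integral)
  have WB: "weighted_volume k f B = enn2real IB"
    unfolding IB_def using B contB fB by (rule weighted_volume_eq_nn_integral)
  define \<nu> where "\<nu> = distr (density ?H (indicator B)) borel \<pi>"
  define \<mu> where "\<mu> = density ?H (indicator A)"
  have [simp, measurable_cong]: "sets \<nu> = sets borel" "sets \<mu> = sets borel"
    by (simp_all add: \<nu>_def \<mu>_def)
  have nu: "emeasure \<nu> S = emeasure ?H (B \<inter> \<pi> -` S)" if [measurable]: "S \<in> sets borel" for S
  proof -
    have [measurable]: "\<pi> -` S \<in> sets borel" using measurable_sets[OF \<pi> that] by simp
    have "emeasure \<nu> S = (\<integral>\<^sup>+x. indicator B x * indicator (\<pi> -` S) x \<partial>?H)"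
      unfolding \<nu>_def by (subst emeasure_distr) (auto simp: emeasure_density)
    also have "\<dots> = (\<integral>\<^sup>+x. indicator (B \<inter> \<pi> -` S) x \<partial>?H)"
      by (intro nn_integral_cong) (auto simp: indicator_def)
    finally show ?thesis by simp
  qed
  have mu: "emeasure \<mu> S = emeasure ?H (A \<inter> S)" if [measurable]: "S \<in> sets borel" for S
  proof -
    have "emeasure \<mu> S = (\<integral>\<^sup>+x. indicator A x * indicator S x \<partial>?H)"
      unfolding \<mu>_def by (subst emeasure_density) auto
    also have "\<dots> = (\<integral>\<^sup>+x. indicator (A \<inter> S) x \<partial>?H)"
      by (intro nn_integral_cong) (auto simp: indicator_def)
    finally show ?thesis by simp
  qed
  have int_nu: "(\<integral>\<^sup>+x. h x \<partial>\<nu>) = (\<integral>\<^sup>+x. h (\<pi> x) * indicator B x \<partial>?H)"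
    if [measurable]: "h \<in> borel_measurable borel" for h
    unfolding \<nu>_def by (subst nn_integral_distr) (auto simp: nn_integral_density mult.commute)
  have int_mu: "(\<integral>\<^sup>+x. h x \<partial>\<mu>) = (\<integral>\<^sup>+x. h x * indicator A x \<partial>?H)"
    if [measurable]: "h \<in> borel_measurable borel" for h
    unfolding \<mu>_def by (subst nn_integral_density) (auto simp: mult.commute)
  \<comment> \<open>\<open>A \<inter> S\<close> is the image under \<open>\<pi>\<close> of the part
    of \<open>B\<close> lying over \<open>S\<close>, and \<open>\<pi>\<close> does not increase
    measure.\<close>
  have le1: "\<mu> \<le> \<nu>"
  proof (subst le_measure, simp, intro ballI)
    fix S assume "S \<in> sets \<mu>"
    then have S[measurable]: "S \<in> sets borel" by simp
    have [measurable]: "\<pi> -` S \<in> sets borel" using measurable_sets[OF \<pi> S] by simp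
    have im: "A \<inter> S = \<pi> ` (B \<inter> \<pi> -` S)" using A by auto
    have "emeasure ?H (\<pi> ` (B \<inter> \<pi> -` S)) \<le> ennreal (1 ^ k) * emeasure ?H (B \<inter> \<pi> -` S)"
    proof (rule emeasure_hausdorff_measure_lipschitz)
      show "\<pi> ` (B \<inter> \<pi> -` S) \<in> sets borel" unfolding im[symmetric] by measurable
    qed (use nonexp in auto)
    then show "emeasure \<mu> S \<le> emeasure \<nu> S" using S by (simp add: mu nu im)
  qed
  have le2: "\<nu> \<le> scale_measure (ennreal (L ^ k)) \<mu>"
  proof (subst le_measure, simp, intro ballI)
    fix S assume "S \<in> sets \<nu>"
    then have S[measurable]: "S \<in> sets borel" by simp
    have [measurable]: "\<pi> -` S \<in> sets borel" using measurable_sets[OF \<pi> S] by simp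
    have inj: "inj_on \<pi> B"
    proof (rule inj_onI)
      fix x y assume "x \<in> B" "y \<in> B" "\<pi> x = \<pi> y"
      with exp[of x y] show "x = y" by simp
    qed
    \<comment> \<open>\<open>G\<close> is the graph map. It inverts \<open>\<pi>\<close> on
      \<open>B\<close>, where \<open>exp\<close> forces injectivity and makes \<open>G\<close>
      Lipschitz with constant \<open>L\<close>.\<close>
    define G where "G = inv_into B \<pi>"
    have G: "G (\<pi> x) = x" if "x \<in> B" for x using inj that by (simp add: G_def)
    have im: "B \<inter> \<pi> -` S = G ` (A \<inter> S)"
    proof (intro subset_antisym subsetI)
      fix x assume x: "x \<in> B \<inter> \<pi> -` S"
      show "x \<in> G ` (A \<inter> S)"
        using x G[of x] by (intro image_eqI[of _ _ "\<pi> x"]) (auto simp: A)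
    qed (auto simp: A G)
    have "emeasure ?H (G ` (A \<inter> S)) \<le> ennreal (L ^ k) * emeasure ?H (A \<inter> S)"
    proof (rule emeasure_hausdorff_measure_lipschitz[OF _ _ L])
      show "G ` (A \<inter> S) \<in> sets borel" unfolding im[symmetric] by measurable
      fix x y assume "x \<in> A \<inter> S" "y \<in> A \<inter> S"
      then show "dist (G x) (G y) \<le> L * dist x y" using A G exp by auto
    qed simp
    then show "emeasure \<nu> S \<le> emeasure (scale_measure (ennreal (L ^ k)) \<mu>) S"
      using S by (simp add: mu nu im)
  qed
  have "bounded (f ` A)" using compact_continuous_image[OF contA cA] by (rule compact_imp_bounded)
  then obtain c where "\<forall>y\<in>f ` A. norm y \<le> c" unfolding bounded_iff by blast
  then have c: "f x \<le> c" if "x \<in> A" for x using that by fastforce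
  have "IA \<le> (\<integral>\<^sup>+x. ennreal c * indicator A x \<partial>?H)"
    unfolding IA_def F_def using c by (intro nn_integral_mono) (auto simp: indicator_def intro: ennreal_leI)
  also have "\<dots> = ennreal c * emeasure ?H A" by (simp add: nn_integral_cmult_indicator)
  also have "\<dots> < \<infinity>" using fin by (simp add: ennreal_mult_less_top)
  finally have IAfin: "IA < \<infinity>" .
  have FA: "F x * indicator A x = F x" for x by (simp add: F_def indicator_def)
  have "IA = (\<integral>\<^sup>+x. F x \<partial>\<mu>)" by (simp add: int_mu IA_def FA)
  also have "\<dots> \<le> (\<integral>\<^sup>+x. F x \<partial>\<nu>)" using le1 by (intro nn_integral_mono_measure) auto
  also have "\<dots> = (\<integral>\<^sup>+x. F (\<pi> x) * indicator B x \<partial>?H)" by (simp add: int_nu)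
  also have "\<dots> \<le> IB"
    unfolding IB_def F_def using lower
    by (intro nn_integral_mono) (auto simp: indicator_def intro: ennreal_leI)
  finally have 1: "IA \<le> IB" .
  have "IB \<le> (\<integral>\<^sup>+x. (F (\<pi> x) + ennreal e * indicator A (\<pi> x)) * indicator B x \<partial>?H)"
    unfolding IB_def F_def using upper f0 e A
    by (intro nn_integral_mono) (auto simp: indicator_def simp flip: ennreal_plus intro!: ennreal_leI)
  also have "\<dots> = (\<integral>\<^sup>+x. F x + ennreal e * indicator A x \<partial>\<nu>)" by (simp add: int_nu)
  also have "\<dots> \<le> (\<integral>\<^sup>+x. F x + ennreal e * indicator A x \<partial>scale_measure (ennreal (L ^ k)) \<mu>)"
    using le2 by (intro nn_integral_mono_measure) auto
  also have "\<dots> = ennreal (L ^ k) * (\<integral>\<^sup>+x. F x + ennreal e * indicator A x \<partial>\<mu>)"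
    by (intro nn_integral_scale_measure) auto
  also have "(\<integral>\<^sup>+x. F x + ennreal e * indicator A x \<partial>\<mu>) = (\<integral>\<^sup>+x. F x + ennreal e * indicator A x \<partial>?H)"
  proof -
    have "(\<lambda>x. F x + ennreal e * indicator A x) \<in> borel_measurable borel" by measurable
    from int_mu[OF this] show ?thesis
      by (simp add: distrib_right mult.assoc FA flip: indicator_inter_arith)
  qed
  also have "\<dots> = IA + ennreal e * emeasure ?H A"
    by (subst nn_integral_add) (auto simp: IA_def nn_integral_cmult_indicator)
  finally have 2: "IB \<le> ennreal (L ^ k) * (IA + ennreal e * emeasure ?H A)" .
  have eq: "ennreal (L ^ k) * (IA + ennreal e * emeasure ?H A)
      = ennreal (L ^ k * (enn2real IA + e * measure ?H A))"
  proof -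
    have "IA = ennreal (enn2real IA)" using IAfin by simp
    moreover have "emeasure ?H A = ennreal (measure ?H A)"
      using fin by (simp add: measure_def)
    ultimately show ?thesis
      using e L by (metis ennreal_mult ennreal_plus enn2real_nonneg measure_nonneg mult_nonneg_nonneg
          zero_le_power less_imp_le add_nonneg_nonneg)
  qed
  have nn: "0 \<le> L ^ k * (enn2real IA + e * measure ?H A)" using L e by simp
  \<comment> \<open>Finiteness matters for the lower bound as well: \<open>enn2real\<close> sends
    \<infinity> to 0 and is monotone only below a finite value.\<close>
  have "IB < \<infinity>" using 2 unfolding eq by (simp add: order_le_less_trans ennreal_less_top)
  with 1 show "weighted_volume k f A \<le> weighted_volume k f B"
    unfolding WA WB by (intro enn2real_mono) auto
  show "weighted_volume k f B \<le> L ^ k * (weighted_volume k f A + e * measure ?H A)"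
    unfolding WA WB using enn2real_leI[OF nn] 2 unfolding eq by auto
qed

section \<open>First variation\<close>

lemma C1_on_imp_continuous_on: "C1_on f S \<Longrightarrow> continuous_on S f"
  unfolding C1_on_def
  by (meson continuous_at_imp_continuous_on has_derivative_continuous)

lemma C2_on_imp_C1_on: "C2_on f S \<Longrightarrow> C1_on f S"
  unfolding C2_on_def C1_on_def[of f] using C1_on_imp_continuous_on by blast

text \<open>The derivative is uniformly continuous on a compact neighbourhood of \<open>A\<close>,
  so the mean value inequality on small balls gives a first-order remainder uniform in the base
  point.\<close>

lemma C1_uniform_first_order:
  fixes f :: "'a::euclidean_space \<Rightarrow> 'b::real_normed_vector"
  assumes f: "\<And>x. x \<in> U \<Longrightarrow> (f has_derivative blinfun_apply (f' x)) (at x)" "continuous_on U f'"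
    and U: "open U" "compact A" "A \<subseteq> U" and e: "0 < e"
  obtains d where "0 < d"
    "\<And>y w :: 'a. y \<in> A \<Longrightarrow> norm w < d \<Longrightarrow> y + w \<in> U \<and> norm (f (y + w) - f y - f' y w) \<le> e * norm w"
proof (cases "A = {}")
  case True
  then show ?thesis using that[of 1] by simp
next
  case False
  obtain r where r: "r > 0" "{x. infdist x A \<le> r} \<subseteq> U"
    using compact_in_open_separated[OF False U(2,1,3)] by metis
  \<comment> \<open>The closed \<open>r\<close>-neighbourhood of \<open>A\<close> is compact and
    inside \<open>U\<close>, and contains every ball of radius at most \<open>r\<close> about a
    point of \<open>A\<close>.\<close>
  define N where "N = {x. infdist x A \<le> r}"
  have "compact N" unfolding N_def using compact_infdist_le[OF False U(2) r(1)] .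
  then have "uniformly_continuous_on N f'"
    using r f(2) by (intro compact_uniformly_continuous) (auto simp: N_def intro: continuous_on_subset)
  then obtain d where d: "d > 0" "\<And>x y. x \<in> N \<Longrightarrow> y \<in> N \<Longrightarrow> dist x y < d \<Longrightarrow> dist (f' x) (f' y) < e"
    unfolding uniformly_continuous_on_def using e by metis
  have N: "z \<in> N" if "y \<in> A" "dist y z < r" for y z
    using infdist_le[OF that(1), of z] that by (simp add: N_def dist_commute)
  show ?thesis
  proof (rule that)
    show "0 < min d r" using d r by simp
    fix y w :: 'a assume y: "y \<in> A" and w: "norm w < min d r"
    have sub: "z \<in> U" if "z \<in> ball y (min d r)" for z
      using N[OF y, of z] that r by (auto simp: N_def)
    have "norm (f (y + w) - f y - f' y (y + w - y)) \<le> norm (y + w - y) * e"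
    proof (rule differentiable_bound_linearization[where S = "ball y (min d r)"])
      fix t :: real assume "t \<in> {0..1}"
      then have "\<bar>t\<bar> * norm w \<le> 1 * norm w" by (intro mult_right_mono) auto
      then show "y + t *\<^sub>R (y + w - y) \<in> ball y (min d r)" using w by (simp add: dist_norm)
    next
      fix z assume z: "z \<in> ball y (min d r)"
      show "(f has_derivative blinfun_apply (f' z)) (at z within ball y (min d r))"
        using f(1)[OF sub[OF z]] by (rule has_derivative_at_withinI)
      have "dist (f' z) (f' y) < e"
        using z N[OF y, of z] N[OF y, of y] r by (intro d) (auto simp: dist_commute)
      moreover have "onorm (blinfun_apply (f' z) - blinfun_apply (f' y)) = norm (f' z - f' y)"
        by (simp add: norm_blinfun.rep_eq minus_blinfun.rep_eq fun_diff_def)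
      ultimately show "onorm (blinfun_apply (f' z) - blinfun_apply (f' y)) \<le> e"
        by (simp add: dist_norm)
    qed (use d r in auto)
    moreover have "y + w \<in> U" using w by (intro sub) (simp add: dist_norm)
    ultimately show "y + w \<in> U \<and> norm (f (y + w) - f y - f' y w) \<le> e * norm w"
      by (simp add: mult.commute)
  qed
qed

text \<open>The derivative is bounded on the compact set \<open>{-1/2..1/2} \<times> K\<close>, so
  the mean value inequality applies in the time variable. The interval is halved to gain
  compactness.\<close>

lemma C1_time_lipschitz:
  fixes F :: "real \<times> 'a::euclidean_space \<Rightarrow> 'b::real_normed_vector"
  assumes F: "C1_on F ({-1<..<1} \<times> U)" and K: "compact K" "K \<subseteq> U"
  obtains C where "0 \<le> C"
    "\<And>t x. \<bar>t\<bar> \<le> 1/2 \<Longrightarrow> x \<in> K \<Longrightarrow> norm (F (t, x) - F (0, x)) \<le> C * \<bar>t\<bar>"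
proof -
  obtain F' where F': "\<And>z. z \<in> {-1<..<1} \<times> U \<Longrightarrow> (F has_derivative blinfun_apply (F' z)) (at z)"
      "continuous_on ({-1<..<1} \<times> U) F'"
    using F unfolding C1_on_def by blast
  have "compact (F' ` ({-1/2..1/2} \<times> K))"
    using F'(2) K by (intro compact_continuous_image compact_Times) (auto elim!: continuous_on_subset)
  then obtain C where C: "C > 0" "\<forall>A\<in>F' ` ({-1/2..1/2} \<times> K). norm A \<le> C"
    using compact_imp_bounded[of "F' ` ({-1/2..1/2} \<times> K)"] unfolding bounded_pos by blast
  show ?thesis
  proof (rule that)
    show "0 \<le> C" using C by simp
    fix t :: real and x assume t: "\<bar>t\<bar> \<le> 1/2" and x: "x \<in> K"
    have "norm (F (t, x) - F (0, x)) \<le> C * norm (t - 0)"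
    proof (rule differentiable_bound[where S = "{-1/2..1/2}"])
      fix s :: real assume s: "s \<in> {-1/2..1/2}"
      have "((\<lambda>s. (s, x)) has_derivative (\<lambda>h. (h, 0))) (at s)"
        by (auto intro!: derivative_eq_intros)
      from has_derivative_compose[OF this F'(1)[of "(s, x)"]]
      show "((\<lambda>s. F (s, x)) has_derivative (\<lambda>h. F' (s, x) (h, 0))) (at s within {-1/2..1/2})"
        using s x K by (auto intro: has_derivative_at_withinI)
      show "onorm (\<lambda>h. F' (s, x) (h, 0)) \<le> C"
      proof (rule onorm_le)
        fix h :: real
        have "norm (F' (s, x) (h, 0)) \<le> norm (F' (s, x)) * norm (h, 0 :: 'a)" by (rule norm_blinfun)
        also have "\<dots> \<le> C * norm h"
          using C(2) s x by (auto simp: norm_Pair intro!: mult_right_mono)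
        finally show "norm (F' (s, x) (h, 0)) \<le> C * norm h" .
      qed
    qed (use t in auto)
    then show "norm (F (t, x) - F (0, x)) \<le> C * \<bar>t\<bar>" by simp
  qed
qed

text \<open>The displacement and its spatial derivative both vanish at time 0 and are Lipschitz in
  time, the latter because the deformation is jointly \<open>C\<^sup>2\<close>. Extending the
  displacement by 0 makes it differentiable on the whole space, which is convex, so a bound on its
  derivative is a global Lipschitz bound.\<close>

lemma deformation_displacement_bounds:
  fixes \<phi> :: "real \<Rightarrow> 'a::euclidean_space \<Rightarrow> 'a"
  assumes \<phi>: "deformation U K \<phi>" and U: "open U"
  defines "d \<equiv> \<lambda>t x. if x \<in> K then \<phi> t x - x else 0"
  obtains C where "0 \<le> C" "\<And>t x. \<bar>t\<bar> \<le> 1/2 \<Longrightarrow> norm (d t x) \<le> C * \<bar>t\<bar>"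
    "\<And>t x y. \<bar>t\<bar> \<le> 1/2 \<Longrightarrow> norm (d t x - d t y) \<le> C * \<bar>t\<bar> * norm (x - y)"
proof -
  let ?F = "\<lambda>(t, x). \<phi> t x"
  let ?D = "{-1<..<1::real} \<times> U"
  have K: "compact K" "K \<subseteq> U" and C2: "C2_on ?F ?D"
    and \<phi>0: "\<And>x. x \<in> U \<Longrightarrow> \<phi> 0 x = x"
    and off: "\<And>t x. t \<in> {-1<..<1} \<Longrightarrow> x \<in> U - K \<Longrightarrow> \<phi> t x = x"
    using \<phi> unfolding deformation_def by blast+
  obtain F' where F': "\<And>z. z \<in> ?D \<Longrightarrow> (?F has_derivative blinfun_apply (F' z)) (at z)" "C1_on F' ?D"
    using C2 unfolding C2_on_def by blast
  obtain C1 where C1: "0 \<le> C1"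
      "\<And>t x. \<bar>t\<bar> \<le> 1/2 \<Longrightarrow> x \<in> K \<Longrightarrow> norm (?F (t, x) - ?F (0, x)) \<le> C1 * \<bar>t\<bar>"
    using C1_time_lipschitz[OF C2_on_imp_C1_on[OF C2] K] by blast
  obtain C2 where C2: "0 \<le> C2"
      "\<And>t x. \<bar>t\<bar> \<le> 1/2 \<Longrightarrow> x \<in> K \<Longrightarrow> norm (F' (t, x) - F' (0, x)) \<le> C2 * \<bar>t\<bar>"
    using C1_time_lipschitz[OF F'(2) K] by blast
  have space_deriv: "(\<phi> t has_derivative (\<lambda>v. F' (t, x) (0, v))) (at x)"
    if "t \<in> {-1<..<1}" "x \<in> U" for t x
  proof -
    have "((\<lambda>x. (t, x)) has_derivative (\<lambda>v. (0, v))) (at x)"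
      by (auto intro!: derivative_eq_intros)
    from has_derivative_compose[OF this F'(1)[of "(t, x)"]] that show ?thesis by simp
  qed
  \<comment> \<open>At time 0 the deformation is the identity on \<open>U\<close>, hence so is its
    spatial derivative.\<close>
  have F'0: "F' (0, x) (0, v) = v" if "x \<in> U" for x v
  proof -
    have "((\<lambda>x. x) has_derivative (\<lambda>v. F' (0, x) (0, v))) (at x)"
      by (rule has_derivative_transform_within_open[OF space_deriv[of 0] U]) (use that \<phi>0 in auto)
    from has_derivative_unique[OF this has_derivative_ident] show ?thesis by (simp add: fun_eq_iff)
  qed
  define d' where "d' t x = (if x \<in> K then (\<lambda>v. F' (t, x) (0, v) - v) else (\<lambda>v. 0))" for t x
  \<comment> \<open>The open sets \<open>U\<close> and \<open>- K\<close> cover the space. On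
    \<open>U\<close> the extension agrees with \<open>\<phi> t x - x\<close>, as points of
    \<open>U - K\<close> do not move; on \<open>- K\<close> it is 0.\<close>
  have dd: "(d t has_derivative d' t x) (at x)" if t: "\<bar>t\<bar> \<le> 1/2" for t x
  proof (cases "x \<in> K")
    case True
    have "((\<lambda>x. \<phi> t x - x) has_derivative (\<lambda>v. F' (t, x) (0, v) - v)) (at x)"
      using t True K by (intro has_derivative_diff space_deriv has_derivative_ident) auto
    moreover have "\<phi> t y - y = d t y" if "y \<in> U" for y
    proof -
      have "t \<in> {-1<..<1}" using t by (auto simp: abs_if split: if_splits)
      then show ?thesis using off[of t y] that by (auto simp: d_def)
    qed
    ultimately have "(d t has_derivative (\<lambda>v. F' (t, x) (0, v) - v)) (at x)"
      using True K U by (auto intro: has_derivative_transform_within_open)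
    then show ?thesis using True by (simp add: d'_def)
  next
    case False
    have "(d t has_derivative (\<lambda>v. 0)) (at x)"
      by (rule has_derivative_transform_within_open[of "\<lambda>_. 0" _ x UNIV "- K"])
        (use False K in \<open>auto simp: d_def open_Compl compact_imp_closed\<close>)
    then show ?thesis using False by (simp add: d'_def)
  qed
  have d'C: "onorm (d' t x) \<le> C2 * \<bar>t\<bar>" if t: "\<bar>t\<bar> \<le> 1/2" for t x
  proof (rule onorm_le)
    fix v
    show "norm (d' t x v) \<le> C2 * \<bar>t\<bar> * norm v"
    proof (cases "x \<in> K")
      case True
      then have "d' t x v = (F' (t, x) - F' (0, x)) (0, v)"
        using F'0[of x v] K by (auto simp: d'_def blinfun.diff_left)
      also have "norm \<dots> \<le> norm (F' (t, x) - F' (0, x)) * norm (0 :: real, v)" by (rule norm_blinfun)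
      also have "\<dots> \<le> C2 * \<bar>t\<bar> * norm v"
        using C2(2)[OF t True] by (auto simp: norm_Pair intro!: mult_right_mono)
      finally show ?thesis .
    qed (use C2 in \<open>simp add: d'_def\<close>)
  qed
  show ?thesis
  proof (rule that[of "max C1 C2"])
    show "0 \<le> max C1 C2" using C1 by simp
    fix t :: real and x y assume t: "\<bar>t\<bar> \<le> 1/2"
    have "C1 * \<bar>t\<bar> \<le> max C1 C2 * \<bar>t\<bar>" by (intro mult_right_mono) auto
    moreover have "norm (d t x) \<le> C1 * \<bar>t\<bar>"
      using C1(1) C1(2)[OF t, of x] \<phi>0[of x] K by (auto simp: d_def)
    ultimately show "norm (d t x) \<le> max C1 C2 * \<bar>t\<bar>" by linarith
    have "norm (d t x - d t y) \<le> (C2 * \<bar>t\<bar>) * norm (x - y)"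
      by (rule differentiable_bound[of UNIV "d t" "d' t"]) (use dd[OF t] d'C[OF t] in auto)
    also have "\<dots> \<le> max C1 C2 * \<bar>t\<bar> * norm (x - y)" by (intro mult_right_mono) auto
    finally show "norm (d t x - d t y) \<le> max C1 C2 * \<bar>t\<bar> * norm (x - y)" .
  qed
qed

text \<open>The upper bound exceeds \<open>F 0\<close> by a term of order \<open>t\<^sup>2\<close>
  and one of order \<open>e * \<bar>t\<bar>\<close>. Since \<open>e\<close> is arbitrary, the
  increment of \<open>F\<close> is nonnegative and at most o(t).\<close>

lemma has_real_derivative_zero_squeeze:
  fixes F :: "real \<Rightarrow> real"
  assumes m: "0 \<le> m"
    and sq: "\<And>e. 0 < e \<Longrightarrow> \<forall>\<^sub>F t in nhds 0. F 0 \<le> F t \<and> F t \<le> (1 + a * t\<^sup>2) ^ k * (F 0 + e * m * \<bar>t\<bar>)"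
  shows "(F has_real_derivative 0) (at 0)"
proof -
  define G where "G t = (1 + a * t\<^sup>2) ^ k" for t :: real
  have dG: "((\<lambda>t. G t * F 0) has_real_derivative 0) (at 0)"
    unfolding G_def by (auto intro!: derivative_eq_intros)
  have G2: "\<forall>\<^sub>F t in nhds 0. G t < 2"
  proof -
    have "isCont G 0" unfolding G_def by (intro continuous_intros)
    then have "(G \<longlongrightarrow> G 0) (nhds 0)"
      unfolding isCont_def by (rule iffD1[OF tendsto_at_iff_tendsto_nhds])
    then show ?thesis by (rule order_tendstoD) (simp add: G_def)
  qed
  show ?thesis
    unfolding has_field_derivative_def has_derivative_at_alt
  proof (intro conjI allI impI)
    fix e :: real assume e: "e > 0"
    have "\<exists>d>0. \<forall>y. norm (y - 0) < d \<longrightarrow>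
        norm (G y * F 0 - G 0 * F 0 - 0 * (y - 0)) \<le> e / 2 * norm (y - 0)"
      using dG e unfolding has_field_derivative_def has_derivative_at_alt by (meson half_gt_zero)
    then obtain d1 where d1: "d1 > 0" "\<And>t. \<bar>t\<bar> < d1 \<Longrightarrow> \<bar>G t * F 0 - F 0\<bar> \<le> e / 2 * \<bar>t\<bar>"
      by (auto simp: G_def)
    \<comment> \<open>Together with \<open>G t < 2\<close> this choice makes the error term at most
      \<open>e / 2 * \<bar>t\<bar>\<close>; the other half is left for \<open>G t * F 0\<close>. The
      summand 1 covers \<open>m = 0\<close>.\<close>
    have "0 < e / (4 * (m + 1))" using e m by simp
    from eventually_conj[OF sq[OF this] G2] obtain d2 where
      d2: "d2 > 0" "\<And>t. \<bar>t\<bar> < d2 \<Longrightarrow> F 0 \<le> F t \<and> F t \<le> G t * (F 0 + e / (4 * (m + 1)) * m * \<bar>t\<bar>) \<and> G t < 2"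
      unfolding eventually_nhds_metric G_def dist_real_def by auto
    have "\<bar>F t - F 0\<bar> \<le> e * \<bar>t\<bar>" if t: "\<bar>t\<bar> < min d1 d2" for t
    proof -
      have "e / (4 * (m + 1)) * m \<le> e / 4" using e m by (simp add: field_simps)
      then have b: "e / (4 * (m + 1)) * m * \<bar>t\<bar> \<le> e / 4 * \<bar>t\<bar>" by (intro mult_right_mono) auto
      have "F t \<le> G t * F 0 + G t * (e / (4 * (m + 1)) * m * \<bar>t\<bar>)"
        using d2(2)[of t] t by (simp add: algebra_simps)
      also have "G t * (e / (4 * (m + 1)) * m * \<bar>t\<bar>) \<le> 2 * (e / 4 * \<bar>t\<bar>)"
        using d2(2)[of t] t e m by (intro mult_mono b) auto
      also have "G t * F 0 \<le> F 0 + e / 2 * \<bar>t\<bar>" using d1(2)[of t] t by linarith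
      finally have "F t \<le> F 0 + e * \<bar>t\<bar>" by simp
      then show ?thesis using d2(2)[of t] t by auto
    qed
    then show "\<exists>d>0. \<forall>y. norm (y - 0) < d \<longrightarrow> norm (F y - F 0 - 0 * (y - 0)) \<le> e * norm (y - 0)"
      using d1 d2 by (intro exI[of _ "min d1 d2"]) auto
  qed (rule bounded_linear_mult_right)
qed

lemma first_variation_zero:
  fixes P U :: "'a::euclidean_space set" and f :: "'a \<Rightarrow> real"
  assumes P: "subspace P" "dim P = k" and U: "open U" and f: "C1_on f U"
    and f0: "\<And>x. x \<in> U \<Longrightarrow> 0 \<le> f x"
    and min: "\<And>p w. p \<in> P \<Longrightarrow> p \<in> U \<Longrightarrow> p + w \<in> U \<Longrightarrow> w \<in> orthogonal_comp P \<Longrightarrow> f p \<le> f (p + w)"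
    and \<phi>: "deformation U K \<phi>"
  shows "((\<lambda>t. weighted_volume k f (\<phi> t ` (P \<inter> K))) has_real_derivative 0) (at 0)"
proof -
  obtain \<pi> where \<pi>: "linear \<pi>" "\<And>x. \<pi> x \<in> P" "\<And>x. x \<in> P \<Longrightarrow> \<pi> x = x"
      "\<And>x y. y \<in> P \<Longrightarrow> (x - \<pi> x) \<bullet> y = 0" "\<And>x. norm (\<pi> x) \<le> norm x"
    by (rule orthonormal_projection[OF P(1)]) (rule that)
  have perp: "x - \<pi> x \<in> orthogonal_comp P" for x
    using \<pi>(4) by (simp add: orthogonal_comp_def orthogonal_def inner_commute)
  have pyth: "(norm x)\<^sup>2 = (norm (\<pi> x))\<^sup>2 + (norm (x - \<pi> x))\<^sup>2" for x
    using norm_add_Pythagorean[of "\<pi> x" "x - \<pi> x"] \<pi>(4)[OF \<pi>(2)[of x], of x]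
    by (simp add: orthogonal_def inner_commute)
  have perp_le: "norm (x - \<pi> x) \<le> norm x" for x
    by (rule power2_le_imp_le) (use pyth[of x] in auto)
  have \<pi>diff: "\<pi> (x - y) = \<pi> x - \<pi> y" for x y using \<pi>(1) by (rule linear_diff)
  have K: "compact K" "K \<subseteq> U" using \<phi> by (auto simp: deformation_def)
  define A where "A = P \<inter> K"
  have A: "compact A" "A \<subseteq> U" "A \<subseteq> P" "A \<subseteq> K"
    using K P(1) by (auto simp: A_def intro: closed_Int_compact closed_subspace)
  have contf: "continuous_on S f" if "S \<subseteq> U" for S
    using C1_on_imp_continuous_on[OF f] that by (rule continuous_on_subset)
  have fin: "emeasure (hausdorff_measure k) A < \<infinity>"
    using A by (intro emeasure_hausdorff_measure_bounded_subspace_finite[OF P])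
      (auto intro: compact_imp_bounded borel_compact)
  define m where "m = measure (hausdorff_measure k) A"
  define F where "F t = weighted_volume k f (\<phi> t ` A)" for t
  have F0: "F 0 = weighted_volume k f A"
  proof -
    have "\<phi> 0 ` A = (\<lambda>x. x) ` A"
      using \<phi> A(2) by (intro image_cong) (auto simp: deformation_def)
    then show ?thesis by (simp add: F_def)
  qed
  define d where "d = (\<lambda>t x. if x \<in> K then \<phi> t x - x else 0)"
  obtain C where C: "0 \<le> C" "\<And>t x. \<bar>t\<bar> \<le> 1/2 \<Longrightarrow> norm (d t x) \<le> C * \<bar>t\<bar>"
      "\<And>t x y. \<bar>t\<bar> \<le> 1/2 \<Longrightarrow> norm (d t x - d t y) \<le> C * \<bar>t\<bar> * norm (x - y)"
    using deformation_displacement_bounds[OF \<phi> U] unfolding d_def by blast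
  obtain f' where f': "\<And>x. x \<in> U \<Longrightarrow> (f has_derivative blinfun_apply (f' x)) (at x)" "continuous_on U f'"
    using f unfolding C1_on_def by blast
  \<comment> \<open>Along a normal line through \<open>y\<close> the density has a local minimum at
    \<open>y\<close>, so its derivative in that direction vanishes.\<close>
  have f'perp: "f' y w = 0" if y: "y \<in> A" and w: "w \<in> orthogonal_comp P" for y w
  proof -
    have "((\<lambda>s. y + s *\<^sub>R w) has_derivative (\<lambda>s. s *\<^sub>R w)) (at 0)"
      by (auto intro!: derivative_eq_intros)
    from has_derivative_compose[OF this, of f "blinfun_apply (f' y)"] f'(1)[of y] y A
    have "((\<lambda>s. f (y + s *\<^sub>R w)) has_derivative (\<lambda>s. f' y (s *\<^sub>R w))) (at 0)" by auto
    then have D: "((\<lambda>s. f (y + s *\<^sub>R w)) has_real_derivative f' y w) (at 0)"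
      by (simp add: has_field_derivative_def blinfun.scaleR_right mult_commute_abs)
    have "isCont (\<lambda>s. y + s *\<^sub>R w) 0" by (intro continuous_intros)
    then have "\<forall>\<^sub>F s in at 0. y + s *\<^sub>R w \<in> U"
      using U y A unfolding isCont_def by (auto intro: topological_tendstoD)
    then obtain r where r: "r > 0" "\<And>s. s \<noteq> 0 \<Longrightarrow> \<bar>s\<bar> < r \<Longrightarrow> y + s *\<^sub>R w \<in> U"
      unfolding eventually_at by (auto simp: dist_real_def)
    have "f (y + 0 *\<^sub>R w) \<le> f (y + s *\<^sub>R w)" if "\<bar>0 - s\<bar> < r" for s
    proof (cases "s = 0")
      case False
      then show ?thesis
        using r(2)[of s] that y A w
        by (auto intro!: min subspace_scale[OF subspace_orthogonal_comp])
    qed simp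
    with DERIV_local_min[OF D r(1)] show ?thesis by blast
  qed
  have "(F has_real_derivative 0) (at 0)"
  \<comment> \<open>\<open>4 * C\<^sup>2\<close> comes from Pythagoras for the slope
    \<open>2 * C * \<bar>t\<bar>\<close> of the graph; \<open>C * m\<close> is the bound on the
    normal displacement per unit time, times the measure of \<open>A\<close>.\<close>
  proof (rule has_real_derivative_zero_squeeze[where a = "4 * C\<^sup>2" and k = k and m = "C * m"])
    show "0 \<le> C * m" using C by (simp add: m_def)
    fix e :: real assume e: "0 < e"
    obtain \<delta> where \<delta>: "0 < \<delta>"
      "\<And>y w. y \<in> A \<Longrightarrow> norm w < \<delta> \<Longrightarrow> y + w \<in> U \<and> norm (f (y + w) - f y - f' y w) \<le> e * norm w"
      using C1_uniform_first_order[OF f' U A(1,2) e] by blast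
    \<comment> \<open>The second condition on \<open>t\<close> makes the displacement a contraction
      with factor 1/2; the third puts normal displacements within reach of the first-order
      estimate.\<close>
    have bounds: "F 0 \<le> F t \<and> F t \<le> (1 + 4 * C\<^sup>2 * t\<^sup>2) ^ k * (F 0 + e * (C * m) * \<bar>t\<bar>)"
      if t: "\<bar>t\<bar> \<le> 1/2" "C * \<bar>t\<bar> \<le> 1/2" "C * \<bar>t\<bar> < \<delta>" for t
    proof -
      define B where "B = \<phi> t ` A"
      define L where "L = 1 + 4 * C\<^sup>2 * t\<^sup>2"
      have L1: "1 \<le> L" by (simp add: L_def)
      have tI: "t \<in> {-1<..<1}" using t(1) by (auto simp: abs_if split: if_splits)
      then obtain \<psi> where "homeomorphism U U (\<phi> t) \<psi>" using \<phi> unfolding deformation_def by blast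
      then have cont\<phi>: "continuous_on U (\<phi> t)" and \<phi>U: "\<phi> t ` U = U"
        by (auto simp: homeomorphism_def)
      have B: "compact B" "B \<subseteq> U"
        unfolding B_def using compact_continuous_image[OF continuous_on_subset[OF cont\<phi> A(2)] A(1)]
          image_mono[OF A(2), of "\<phi> t"] \<phi>U by simp_all
      have \<phi>d: "\<phi> t x = x + d t x" if "x \<in> A" for x using that A by (auto simp: d_def)
      have dLip: "norm (d t x - d t y) \<le> 1/2 * norm (x - y)" for x y
        using C(3)[OF t(1), of x y] mult_right_mono[OF t(2), of "norm (x - y)"] by simp
      \<comment> \<open>On \<open>A\<close> this is the projected deformation, but it is defined
        everywhere and is a perturbation of the identity by a contraction.\<close>
      define q where "q x = x + \<pi> (d t x)" for x
      have q\<phi>: "\<pi> (\<phi> t x) = q x" if "x \<in> A" for x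
        using that A \<pi>(1,3) by (auto simp: \<phi>d q_def linear_add)
      have qexp: "norm (x - y) \<le> 2 * norm (q x - q y)" for x y
      proof -
        have "norm (x - y) = norm ((q x - q y) - \<pi> (d t x - d t y))"
          by (simp add: q_def \<pi>diff)
        also have "\<dots> \<le> norm (q x - q y) + norm (\<pi> (d t x - d t y))" by (rule norm_triangle_ineq4)
        also have "norm (\<pi> (d t x - d t y)) \<le> 1/2 * norm (x - y)"
          using \<pi>(5) dLip order_trans by blast
        finally show ?thesis by simp
      qed
      have qP: "q x \<in> P" if "x \<in> P" for x using that \<pi>(2) P(1) by (simp add: q_def subspace_add)
      have qoff: "q x = x" if "x \<notin> K" for x using that \<pi>(1) by (simp add: q_def d_def linear_0)
      have qA: "q ` A = A"
      proof
        show "q ` A \<subseteq> A"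
        \<comment> \<open>If \<open>q x\<close> left \<open>K\<close> it would be fixed by
          \<open>q\<close>; injectivity then gives \<open>q x = x\<close>, a point of
          \<open>A\<close>.\<close>
        proof (rule image_subsetI, rule ccontr)
          fix x assume x: "x \<in> A" "q x \<notin> A"
          then have "q x \<notin> K" using qP A by (auto simp: A_def)
          with qoff have "q (q x) = q x" by blast
          with qexp[of "q x" x] have "q x = x" by simp
          with x show False by simp
        qed
        show "A \<subseteq> q ` A"
        proof
          fix y assume y: "y \<in> A"
          \<comment> \<open>Solving \<open>q x = y\<close> in \<open>P\<close> is a fixed point
            problem for a contraction. The solution lies in \<open>K\<close>, because off
            \<open>K\<close> it would have to equal \<open>y\<close>.\<close>
          have "\<exists>!x. x \<in> P \<and> y - \<pi> (d t x) = x"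
          proof (rule Banach_fix[where c = "1/2"])
            show "complete P" using P(1) by (simp add: closed_subspace complete_eq_closed)
            show "P \<noteq> {}" using P(1) subspace_0 by blast
            show "(\<lambda>x. y - \<pi> (d t x)) ` P \<subseteq> P"
              using y A P(1) \<pi>(2) by (auto intro: subspace_diff)
            fix x z
            have "dist (y - \<pi> (d t x)) (y - \<pi> (d t z)) = norm (\<pi> (d t x - d t z))"
              by (simp add: \<pi>diff dist_norm norm_minus_commute)
            also have "\<dots> \<le> 1/2 * norm (x - z)" using \<pi>(5) dLip order_trans by blast
            finally show "dist (y - \<pi> (d t x)) (y - \<pi> (d t z)) \<le> 1/2 * dist x z"
              by (simp add: dist_norm)
          qed auto
          then obtain x where x: "x \<in> P" "y - \<pi> (d t x) = x" by blast
          then have "q x = y" by (simp add: q_def algebra_simps)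
          moreover have "x \<in> K" using qoff[of x] \<open>q x = y\<close> y A(4) by (cases "x \<in> K") auto
          ultimately show "y \<in> q ` A" using x by (auto simp: A_def)
        qed
      qed
      have AB: "A = \<pi> ` B"
        using qA q\<phi> by (simp add: B_def image_image cong: image_cong)
      have exp: "dist u v \<le> L * dist (\<pi> u) (\<pi> v)" if uv: "u \<in> B" "v \<in> B" for u v
      proof -
        obtain x y where xy: "x \<in> A" "y \<in> A" "u = \<phi> t x" "v = \<phi> t y" using uv by (auto simp: B_def)
        define n where "n = norm (\<pi> u - \<pi> v)"
        have n: "n = norm (q x - q y)" using xy q\<phi> by (simp add: n_def)
        \<comment> \<open>\<open>x - y\<close> lies in \<open>P\<close>, so only the displacements
          contribute to the normal part of \<open>u - v\<close>.\<close>
        have "(u - v) - \<pi> (u - v) = (d t x - d t y) - \<pi> (d t x - d t y)"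
          using xy A \<pi>(3) q\<phi> unfolding \<pi>diff by (simp add: \<phi>d q_def)
        then have "norm ((u - v) - \<pi> (u - v)) \<le> norm (d t x - d t y)" using perp_le by simp
        also have "\<dots> \<le> C * \<bar>t\<bar> * norm (x - y)" by (rule C(3)[OF t(1)])
        also have "\<dots> \<le> C * \<bar>t\<bar> * (2 * n)" using C(1) qexp n by (intro mult_left_mono) auto
        finally have "(norm ((u - v) - \<pi> (u - v)))\<^sup>2 \<le> (C * \<bar>t\<bar> * (2 * n))\<^sup>2"
          by (intro power_mono) auto
        then have "(norm (u - v))\<^sup>2 \<le> L * n\<^sup>2"
          using pyth[of "u - v"] by (simp add: \<pi>diff n_def L_def power_mult_distrib algebra_simps)
        \<comment> \<open>Using \<open>L\<close> instead of its square root as Lipschitz constant is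
          harmless, since \<open>L\<close> is already \<open>1 + O(t\<^sup>2)\<close>.\<close>
        also have "\<dots> \<le> L\<^sup>2 * n\<^sup>2"
          using L1 by (intro mult_right_mono) (auto simp: power2_eq_square)
        finally have "(norm (u - v))\<^sup>2 \<le> (L * n)\<^sup>2" by (simp add: power_mult_distrib)
        then have "norm (u - v) \<le> L * n"
          by (rule power2_le_imp_le) (use L1 in \<open>simp add: n_def\<close>)
        then show ?thesis by (simp add: dist_norm n_def)
      qed
      have fB: "f (\<pi> u) \<le> f u \<and> f u \<le> f (\<pi> u) + e * (C * \<bar>t\<bar>)" if u: "u \<in> B" for u
      proof -
        obtain x where x: "x \<in> A" "u = \<phi> t x" using u by (auto simp: B_def)
        have \<pi>u: "\<pi> u \<in> A" using AB u by blast
        define w where "w = u - \<pi> u"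
        have w: "w \<in> orthogonal_comp P" "u = \<pi> u + w" using perp by (auto simp: w_def)
        have "w = d t x - \<pi> (d t x)" using x q\<phi> by (simp add: w_def \<phi>d q_def)
        then have nw: "norm w \<le> C * \<bar>t\<bar>" using perp_le C(2)[OF t(1)] order_trans by metis
        have "f (\<pi> u) \<le> f (\<pi> u + w)"
          using \<pi>u A B u w by (intro min) auto
        moreover have "norm (f (\<pi> u + w) - f (\<pi> u) - f' (\<pi> u) w) \<le> e * norm w"
          using \<delta>(2)[OF \<pi>u, of w] nw t(3) by simp
        moreover have "e * norm w \<le> e * (C * \<bar>t\<bar>)" using nw e by (intro mult_left_mono) auto
        \<comment> \<open>The first-order term drops out because \<open>w\<close> is normal to
          \<open>P\<close>.\<close>
        ultimately show ?thesis using f'perp[OF \<pi>u w(1)] w(2) by simp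
      qed
      have nonexp: "dist (\<pi> x) (\<pi> y) \<le> dist x y" for x y
        using \<pi>(5)[of "x - y"] by (simp add: dist_norm \<pi>diff)
      have "0 < L" using L1 by simp
      have "0 \<le> e * (C * \<bar>t\<bar>)" using e C(1) by simp
      note wv = weighted_volume_projection_bounds[OF B(1) AB nonexp \<open>0 < L\<close> exp contf[OF A(2)]
          contf[OF B(2)] _ this _ _ fin]
      have "weighted_volume k f A \<le> weighted_volume k f B"
        by (rule wv(1)) (use f0 A fB in auto)
      moreover have "weighted_volume k f B
          \<le> L ^ k * (weighted_volume k f A + e * (C * \<bar>t\<bar>) * measure (hausdorff_measure k) A)"
        by (rule wv(2)) (use f0 A fB in auto)
      ultimately show ?thesis
        by (simp add: F0 m_def L_def mult_ac) (simp add: F_def B_def)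
    qed
    \<comment> \<open>Dividing by \<open>C + 1\<close> yields both bounds on
      \<open>C * \<bar>t\<bar>\<close> and stays meaningful for \<open>C = 0\<close>.\<close>
    have "\<forall>\<^sub>F t in nhds 0. \<bar>t\<bar> < min (1/2) (min (1/2) \<delta> / (C + 1))"
      using \<delta>(1) C(1) by (intro eventually_nhds_metric[THEN iffD2] exI[of _ "min (1/2) (min (1/2) \<delta> / (C + 1))"])
        (auto simp: dist_real_def)
    then show "\<forall>\<^sub>F t in nhds 0. F 0 \<le> F t \<and> F t \<le> (1 + 4 * C\<^sup>2 * t\<^sup>2) ^ k * (F 0 + e * (C * m) * \<bar>t\<bar>)"
    proof eventually_elim
      case (elim t)
      then have "\<bar>t\<bar> * (C + 1) < min (1/2) \<delta>" using C(1) by (simp add: pos_less_divide_eq del: min_less_iff_conj)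
      moreover have "\<bar>t\<bar> * (C + 1) = C * \<bar>t\<bar> + \<bar>t\<bar>" by (simp add: algebra_simps)
      ultimately have "C * \<bar>t\<bar> < min (1/2) \<delta>" using abs_ge_zero[of t] by linarith
      with elim show ?case by (intro bounds) auto
    qed
  qed
  then show ?thesis by (simp add: F_def [abs_def] A_def)
qed

section \<open>Radial densities and stability\<close>

text \<open>Second derivative test on the line through \<open>p\<close> in direction
  \<open>v\<close>: a negative second derivative would make \<open>h'\<close> negative just to the
  right of 0, and \<open>h\<close> would drop below its minimum.\<close>

lemma Hess_nonneg_of_local_min:
  fixes f :: "'a::euclidean_space \<Rightarrow> real"
  assumes f: "C2_on f U" "open U" "p \<in> U" and min: "\<And>s::real. p + s *\<^sub>R v \<in> U \<Longrightarrow> f p \<le> f (p + s *\<^sub>R v)"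
  shows "0 \<le> Hess f p v v"
proof -
  obtain f' where f': "\<And>x. x \<in> U \<Longrightarrow> (f has_derivative blinfun_apply (f' x)) (at x)" "C1_on f' U"
    using f(1) unfolding C2_on_def by blast
  then obtain f'' where f'': "(f' has_derivative f'') (at p)"
    using f unfolding C1_on_def by blast
  have fd: "frechet_derivative f (at x) = blinfun_apply (f' x)" if "x \<in> U" for x
    using frechet_derivative_at[OF f'(1)[OF that]] by simp
  have "((\<lambda>y. f' y v) has_derivative (\<lambda>w. f'' w v)) (at p)"
    by (rule blinfun.FDERIV[OF f'' has_derivative_const, of v, simplified])
  \<comment> \<open>Near \<open>p\<close> the Frechet derivative in \<open>Hess\<close> is the given
    \<open>f'\<close>, which identifies the Hessian with \<open>f''\<close>.\<close>
  then have "((\<lambda>y. frechet_derivative f (at y) v) has_derivative (\<lambda>w. f'' w v)) (at p)"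
    by (rule has_derivative_transform_within_open[OF _ f(2,3)]) (simp add: fd)
  from frechet_derivative_at[OF this] have H: "Hess f p v v = f'' v v"
    by (simp add: Hess_def fun_eq_iff)
  define h where "h s = f (p + s *\<^sub>R v)" for s
  define h' where "h' s = f' (p + s *\<^sub>R v) v" for s
  have dh: "(h has_real_derivative h' s) (at s)" if "p + s *\<^sub>R v \<in> U" for s
  proof -
    have "((\<lambda>s. p + s *\<^sub>R v) has_derivative (\<lambda>t. t *\<^sub>R v)) (at s)"
      by (auto intro!: derivative_eq_intros)
    from has_derivative_compose[OF this f'(1)[OF that]] show ?thesis
      unfolding h_def h'_def has_field_derivative_def
      by (simp add: blinfun.scaleR_right mult_commute_abs)
  qed
  have dh': "(h' has_real_derivative f'' v v) (at 0)"
  proof -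
    have l: "((\<lambda>s. p + s *\<^sub>R v) has_derivative (\<lambda>t. t *\<^sub>R v)) (at 0)"
      by (auto intro!: derivative_eq_intros)
    have "((\<lambda>s. f' (p + s *\<^sub>R v)) has_derivative (\<lambda>t. f'' (t *\<^sub>R v))) (at 0)"
      using has_derivative_compose[OF l, of f' f''] f'' by simp
    from blinfun.FDERIV[OF this has_derivative_const, of v]
    show ?thesis
      unfolding h'_def has_field_derivative_def
      using linear_scale[OF has_derivative_linear[OF f'']]
      by (simp add: blinfun.scaleR_left mult_commute_abs)
  qed
  obtain d where d: "d > 0" "\<And>s. \<bar>s\<bar> < d \<Longrightarrow> p + s *\<^sub>R v \<in> U"
  proof -
    have "isCont (\<lambda>s. p + s *\<^sub>R v) 0" by (intro continuous_intros)
    then have "\<forall>\<^sub>F s in at 0. p + s *\<^sub>R v \<in> U"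
      using f unfolding isCont_def by (auto intro: topological_tendstoD)
    then show ?thesis using that f unfolding eventually_at dist_real_def
      by (metis (no_types, lifting) UNIV_I diff_zero add.right_neutral scale_zero_left)
  qed
  have min': "h 0 \<le> h s" if "\<bar>s\<bar> < d" for s using min d(2)[OF that] by (simp add: h_def)
  have "h' 0 = 0"
    using DERIV_local_min[OF dh d(1)] min' d by (simp add: f)
  show ?thesis
  proof (rule ccontr)
    assume "\<not> ?thesis"
    then have "f'' v v < 0" by (simp add: H)
    from DERIV_neg_dec_right[OF dh' this] obtain e where
      e: "e > 0" "\<And>s. 0 < s \<Longrightarrow> s < e \<Longrightarrow> h' s < 0" using \<open>h' 0 = 0\<close> by auto
    define s where "s = min d e / 2"
    have s: "0 < s" "s < d" "s < e" using d e by (auto simp: s_def)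
    have "h s < h 0"
    proof (rule DERIV_neg_imp_decreasing_open[OF s(1)])
      fix x assume "0 < x" "x < s"
      then show "\<exists>y. (h has_real_derivative y) (at x) \<and> y < 0"
        using dh d e s by (intro exI[of _ "h' x"]) auto
    next
      show "continuous_on {0..s} h"
        using dh d s by (intro continuous_at_imp_continuous_on ballI DERIV_isCont[OF dh]) auto
    qed
    with min'[of s] s show False by simp
  qed
qed

text \<open>Away from the origin this is monotonicity of \<open>g\<close>, obtained from the sign of
  its derivative. The origin, when it belongs to \<open>U\<close>, is reached by continuity of
  \<open>f\<close>.\<close>

lemma radial_mono:
  fixes f :: "'a::euclidean_space \<Rightarrow> real" and g :: "real \<Rightarrow> real"
  assumes rad: "\<And>x. f x = g (norm x)" and g': "\<And>t. 0 < t \<Longrightarrow> 0 \<le> deriv g t"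
    and U: "U = UNIV \<or> U = UNIV - {0}" and f: "C1_on f U"
    and x: "x \<in> U" and le: "norm x \<le> norm y"
  shows "f x \<le> f y"
proof (cases "y = 0")
  case True
  then show ?thesis using le by simp
next
  case False
  define e where "e = y /\<^sub>R norm y"
  have e: "norm e = 1" using False by (simp add: e_def)
  obtain f' where f': "\<And>x. x \<in> U \<Longrightarrow> (f has_derivative blinfun_apply (f' x)) (at x)"
    using f unfolding C1_on_def by blast
  \<comment> \<open>\<open>deriv g t\<close> carries information only if \<open>g\<close> is
    differentiable at \<open>t\<close>; this is inherited from \<open>f\<close> along the ray
    spanned by the unit vector \<open>e\<close>.\<close>
  have g: "(g has_real_derivative deriv g t) (at t)" if t: "0 < t" for t
  proof -
    have "t *\<^sub>R e \<in> U" using U e t by auto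
    moreover have "((\<lambda>s. s *\<^sub>R e) has_derivative (\<lambda>s. s *\<^sub>R e)) (at t)"
      by (auto intro!: derivative_eq_intros)
    ultimately have "((\<lambda>s. f (s *\<^sub>R e)) has_derivative (\<lambda>s. f' (t *\<^sub>R e) (s *\<^sub>R e))) (at t)"
      using has_derivative_compose f' by blast
    then have "((\<lambda>s. f (s *\<^sub>R e)) has_real_derivative f' (t *\<^sub>R e) e) (at t)"
      by (simp add: has_field_derivative_def blinfun.scaleR_right mult_commute_abs)
    then have "(g has_real_derivative f' (t *\<^sub>R e) e) (at t)"
      by (rule has_field_derivative_transform_within_open[of _ _ _ "{0<..}"])
        (use t e in \<open>auto simp: rad\<close>)
    with DERIV_imp_deriv[OF this] show ?thesis by simp
  qed
  have mono: "g s \<le> g t" if "0 < s" "s \<le> t" for s t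
  proof (rule DERIV_nonneg_imp_nondecreasing[OF that(2)])
    fix x assume "s \<le> x"
    with that(1) have "0 < x" by simp
    then show "\<exists>y. (g has_real_derivative y) (at x) \<and> 0 \<le> y" using g g' by blast
  qed
  show ?thesis
  proof (cases "x = 0")
    case False
    then show ?thesis using mono[of "norm x" "norm y"] le by (simp add: rad)
  next
    case True
    have "isCont f 0" using f'[of 0] x True has_derivative_continuous by blast
    moreover have "((\<lambda>s. s *\<^sub>R y) \<longlongrightarrow> 0 *\<^sub>R y) (at_right (0 :: real))"
      by (intro tendsto_intros)
    ultimately have "((\<lambda>s. f (s *\<^sub>R y)) \<longlongrightarrow> f x) (at_right (0 :: real))"
      using True isCont_tendsto_compose[of 0 f] by simp
    \<comment> \<open>The values at \<open>s *\<^sub>R y\<close> with \<open>0 < s < 1\<close> are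
      at most \<open>f y\<close> and converge to the value at the origin.\<close>
    moreover have "\<forall>\<^sub>F s in at_right (0::real). f (s *\<^sub>R y) \<le> f y"
    proof -
      have "\<forall>\<^sub>F s in at_right (0::real). s \<in> {0<..<1}"
        by (rule eventually_at_right_real) simp
      then show ?thesis
      proof eventually_elim
        case (elim s)
        then show ?case
          using mono[of "norm (s *\<^sub>R y)" "norm y"] \<open>y \<noteq> 0\<close>
          by (simp add: rad mult_left_le_one_le)
      qed
    qed
    ultimately show ?thesis by (rule tendsto_upperbound) simp
  qed
qed

text \<open>The sign of \<open>g\<close> is given only for positive arguments; at the origin the
  value is a limit of nonnegative ones.\<close>

lemma radial_nonneg:
  fixes f :: "'a::euclidean_space \<Rightarrow> real" and g :: "real \<Rightarrow> real"
  assumes rad: "\<And>x. f x = g (norm x)" and g0: "\<And>t. 0 < t \<Longrightarrow> 0 \<le> g t"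
    and f: "C1_on f U" and x: "x \<in> U" and U: "open U"
  shows "0 \<le> f x"
proof (cases "x = 0")
  case False
  then show ?thesis using g0 by (simp add: rad)
next
  case True
  have "isCont f 0" using C1_on_imp_continuous_on[OF f] U x True continuous_on_eq_continuous_at by blast
  then have "(f \<longlongrightarrow> f 0) (at 0)" by (simp add: isCont_def)
  moreover have "\<forall>\<^sub>F y in at 0. 0 \<le> f y"
    using g0 by (auto simp: eventually_at_filter rad)
  ultimately show ?thesis unfolding True by (rule tendsto_lowerbound) simp
qed

theorem theorem1p4:
  fixes k :: nat and f :: "real ^ 'n \<Rightarrow> real" and g :: "real \<Rightarrow> real"
    and U P :: "(real ^ 'n) set"
  assumes "1 \<le> k" and "k \<le> CARD('n) - 1"
    and "\<And>x. f x = g (norm x)"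
    and "\<And>t. 0 < t \<Longrightarrow> 0 \<le> g t"
    and "\<And>t. 0 < t \<Longrightarrow> 0 \<le> deriv g t"
    and "U = UNIV \<or> U = UNIV - {0}"
    and "C2_on f U"
    and "subspace P" and "dim P = k"
  shows "f_stable k U f P"
proof -
  have U: "open U" using assms(6) by auto
  have C1: "C1_on f U" using assms(7) by (rule C2_on_imp_C1_on)
  have f0: "0 \<le> f x" if "x \<in> U" for x
    using assms(3,4) C1 that U by (rule radial_nonneg)
  have min: "f p \<le> f (p + w)" if "p \<in> P" "p \<in> U" "w \<in> orthogonal_comp P" for p w
  proof (rule radial_mono[OF assms(3,5,6) C1 \<open>p \<in> U\<close>])
    have "orthogonal p w" using that by (simp add: orthogonal_comp_def)
    from norm_add_Pythagorean[OF this] show "norm p \<le> norm (p + w)"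
      by (auto intro!: power2_le_imp_le[of "norm p"])
  qed
  \<comment> \<open>\<open>1 \<le> k\<close> gives \<open>P\<close> a nonzero point, so
    \<open>P\<close> meets \<open>U\<close> even when the origin is removed.\<close>
  have "U \<inter> P \<noteq> {}"
  proof
    assume "U \<inter> P = {}"
    then have "P \<subseteq> {0}" using assms(6) by auto
    then have "dim P = 0" by (simp only: dim_eq_0)
    then show False using assms(1,9) by simp
  qed
  then have adm: "admissible_submanifold k U P"
    using admissible_subspace[OF assms(8)] assms(9) by simp
  have stationary: "f_stationary k U f P"
    unfolding f_stationary_def
    using adm first_variation_zero[OF assms(8,9) U C1 f0 min] by blast
  show ?thesis
    unfolding f_stable_def
  proof (intro conjI allI impI stationary)
    fix X assume X: "normal_test_field U P X"
    have "f p * ((\<Sum>u\<in>tangent_frame P p. \<Sum>v\<in>tangent_frame P p. (second_fundamental_form P p u v \<bullet> X p)\<^sup>2)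
        + (mean_curvature P p \<bullet> X p)\<^sup>2) = 0" if "p \<in> P" for p
    proof -
      have "second_fundamental_form P p u v = 0"
        if "u \<in> tangent_frame P p" "v \<in> tangent_frame P p" for u v
        using that tangent_frame_subspace[OF assms(8) \<open>p \<in> P\<close>]
        by (intro second_fundamental_form_subspace[OF assms(8) \<open>p \<in> P\<close>]) auto
      then show ?thesis by (simp add: mean_curvature_subspace[OF assms(8) that])
    qed
    then have "(LINT p:P \<inter> U|hausdorff_measure k.
           f p * ((\<Sum>u\<in>tangent_frame P p. \<Sum>v\<in>tangent_frame P p. (second_fundamental_form P p u v \<bullet> X p)\<^sup>2)
                  + (mean_curvature P p \<bullet> X p)\<^sup>2)) = (LINT p|(hausdorff_measure k :: (real ^ 'n) measure). 0)"
      unfolding set_lebesgue_integral_def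
      by (intro Bochner_Integration.integral_cong) (auto simp: indicator_def)
    also have "\<dots> \<le> (LINT p:P \<inter> U|hausdorff_measure k.
             f p * (\<Sum>u\<in>tangent_frame P p. (norm (normal_part P p (flat_deriv P p u X)))\<^sup>2)
             + Hess f p (X p) (X p))"
      unfolding set_lebesgue_integral_def Bochner_Integration.integral_zero
    \<comment> \<open>Pointwise nonnegativity suffices: a non-integrable function has Bochner
      integral 0 by convention.\<close>
    proof (rule Bochner_Integration.integral_nonneg)
      fix p
      show "0 \<le> indicator (P \<inter> U) p *\<^sub>R (f p * (\<Sum>u\<in>tangent_frame P p. (norm (normal_part P p (flat_deriv P p u X)))\<^sup>2)
             + Hess f p (X p) (X p))"
      proof (cases "p \<in> P \<inter> U")
        case True
        have "X p \<in> orthogonal_comp P"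
          using X True tangent_space_subspace[OF assms(8)] by (auto simp: normal_test_field_def)
        \<comment> \<open>The line through \<open>p\<close> in direction \<open>X p\<close> is
          normal to \<open>P\<close>, so \<open>f\<close> restricted to its part in \<open>U\<close>
          is minimal at \<open>p\<close>.\<close>
        then have "0 \<le> Hess f p (X p) (X p)"
          using True by (intro Hess_nonneg_of_local_min[OF assms(7) U] min
              subspace_scale[OF subspace_orthogonal_comp]) auto
        then show ?thesis using True f0[of p] by (simp add: sum_nonneg)
      qed simp
    qed
    finally show "(LINT p:P \<inter> U|hausdorff_measure k.
           f p * ((\<Sum>u\<in>tangent_frame P p. \<Sum>v\<in>tangent_frame P p. (second_fundamental_form P p u v \<bullet> X p)\<^sup>2)
                  + (mean_curvature P p \<bullet> X p)\<^sup>2))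
        \<le> (LINT p:P \<inter> U|hausdorff_measure k.
             f p * (\<Sum>u\<in>tangent_frame P p. (norm (normal_part P p (flat_deriv P p u X)))\<^sup>2)
             + Hess f p (X p) (X p))" .
  qed
qed

end
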